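(* Let $\kappa\in\{1/2,3/2\}$ and let $\mathbf g=(g_1,\dots,g_r):\mathbb H\to\mathbb C^r$ be a vector-valued cusp form of weight $\kappa$ for $\mathsf{Mp}_2(\mathbb Z)$ with unitary multiplier system $\varrho$, where $\varrho(T)=\mathrm{diag}(e^{2\pi i\alpha_1},\dots,e^{2\pi i\alpha_r})$ has finite order, $\alpha_k\in\mathbb Q\cap[0,1)$, and let $D$ be the common denominator of $\alpha_1,\dots,\alpha_r$. Let $\widetilde{\mathsf{EI}}[\mathbf g](\tau)=\sum_{\ell\ge0}\mathbf c_\ell\tau^\ell$ be the asymptotic expansion of $\mathsf{EI}[\mathbf g](\tau)$ as $\tau\to0$ with $\mathrm{Im}(\tau)>0$. Then: (i) Away from the origin, the Borel transform $\mathcal B\big[\tau^{2-\kappa}\,\widetilde{\mathsf{EI}}[\mathbf g]\big](\xi)$ is meromorphic with only simple poles, located at points $\xi_\lambda=2\pi i\lambda$ with $\lambda\in\frac1D\mathbb Z_{>0}$. With $\mathbf{St}_\lambda$ defined by the local form $-\frac{\mathbf{St}_\lambda}{2\pi i(\xi-\xi_\lambda)}+(\text{regular})$ near $\xi_\lambda$, the Stokes vectors satisfy $\mathbf{St}_\lambda=C\,\lambda^{1-\kappa}\,\varrho(S)\,\mathbf a(\lambda)$ for a nonzero constant $C$ depending only on $\kappa$, and they have polynomial growth in $\lambda$. (ii) The Stokes–Dirichlet vector satisfies $\sum_{m\ge1}\mathbf{St}_{m/D}\,m^{-s}=C\,D^{-s}\,\varrho(S)\,\boldsymbol{\mathscr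 L}(s+\kappa-1)$, and it admits meromorphic continuation to $\mathbb C$: the completed vector $\boldsymbol\Lambda(s)=(2\pi)^{-s}\Gamma(s)\boldsymbol{\mathscr L}(s)$ extends to an entire function satisfying $\boldsymbol\Lambda(s)=i^\kappa\,\varrho(S)\,\boldsymbol\Lambda(\kappa-s)$ for all $s\in\mathbb C$.
   Context: $\mathbb H$ is the upper half-plane, $q=e^{2\pi i\tau}$, $T=\begin{pmatrix}1&1\\0&1\end{pmatrix}$, $S=\begin{pmatrix}0&-1\\1&0\end{pmatrix}$; powers of $c\tau+d$ use the principal branch. A multiplier system of weight $\kappa$ is a map $\varrho:\mathsf{SL}_2(\mathbb Z)\to\mathsf{GL}_r(\mathbb C)$ such that $\mathbf j(\tau;\gamma)=(c\tau+d)^\kappa\varrho(\gamma)$ satisfies $\mathbf j(\tau;\gamma\gamma')=\mathbf j(\gamma'\tau;\gamma)\,\mathbf j(\tau;\gamma')$ (equivalently, it comes from a representation of $\mathsf{Mp}_2(\mathbb Z)$). That $\mathbf g$ is a cusp form of weight $\kappa$ and multiplier $\varrho$ means that $\mathbf g$ is holomorphic, $\mathbf g(\gamma\tau)=(c\tau+d)^\kappa\varrho(\gamma)\mathbf g(\tau)$ for all $\gamma\in\mathsf{SL}_2(\mathbb Z)$, and $g_k(\tau)=\sum_{\lambda\in\alpha_k+\mathbb Z_{\ge0},\lambda>0}a_k(\lambda)q^\lambda$ with $a_k(\lambda)=O(\lambda^{\kappa/2})$. Set $a_k(\lambda)=0$ for $\lambda\notin\alpha_k+\mathbb Z_{\ge0}$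 and $\mathbf a=(a_1,\dots,a_r)$. The Eichler integrals are $\mathsf{EI}[g_k](\tau)=\sum_\lambda\lambda^{1-\kappa}a_k(\lambda)q^\lambda$, $\mathsf{EI}[\mathbf g]=(\mathsf{EI}[g_k])_k$; the Dirichlet vector is $\boldsymbol{\mathscr L}=(\mathscr L_k)_k$, $\mathscr L_k(s)=\sum_\lambda a_k(\lambda)\lambda^{-s}$. The Borel transform is $\mathcal B[\tau^a](\xi)=\xi^{a-1}/\Gamma(a)$ for $a>0$, extended term by term and analytically continued (up to the possibly multivalued factor $\xi^{1-\kappa}$ at the origin, taken with the principal branch). A Stokes vector or a component of it may vanish, in which case there is no pole at the corresponding point. *)

theory Defs
  imports
    "HOL-Complex_Analysis.Complex_Analysis"
    "HOL-Library.Landau_Symbols"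
    "Jordan_Normal_Form.Schur_Decomposition"
begin

(* Vectors and matrices are those of Jordan_Normal_Form, so that the dimension r is an ordinary
   natural number; components are indexed by k < r.  The HOL-Analysis and formal power series
   readings of "$" are switched off. *)
unbundle no vec_syntax and no fps_syntax

definition upper_half_plane :: "complex set" where
  "upper_half_plane = {\<tau>. Im \<tau> > 0}"

definition SL2Z :: "int mat set" where
  "SL2Z = {\<gamma> \<in> carrier_mat 2 2. Determinant.det \<gamma> = 1}"

definition T_mat :: "int mat" where
  "T_mat = mat_of_rows_list 2 [[1, 1], [0, 1]]"

definition S_mat :: "int mat" where
  "S_mat = mat_of_rows_list 2 [[0, - 1], [1, 0]]"

definition denom :: "int mat \<Rightarrow> complex \<Rightarrow> complex" where
  "denom \<gamma> \<tau> = of_int (\<gamma> $$ (1, 0)) * \<tau> + of_int (\<gamma> $$ (1, 1))"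

definition moebius :: "int mat \<Rightarrow> complex \<Rightarrow> complex" where
  "moebius \<gamma> \<tau> = (of_int (\<gamma> $$ (0, 0)) * \<tau> + of_int (\<gamma> $$ (0, 1))) / denom \<gamma> \<tau>"

(* Complex powr is exp (w * Ln z) with the principal logarithm, - pi < Im (Ln z) <= pi. *)
definition automorphy ::
    "real \<Rightarrow> (int mat \<Rightarrow> complex mat) \<Rightarrow> int mat \<Rightarrow> complex \<Rightarrow> complex mat" where
  "automorphy \<kappa> \<rho> \<gamma> \<tau> = (denom \<gamma> \<tau> powr of_real \<kappa>) \<cdot>\<^sub>m \<rho> \<gamma>"

definition multiplier_system :: "nat \<Rightarrow> real \<Rightarrow> (int mat \<Rightarrow> complex mat) \<Rightarrow> bool" where
  "multiplier_system r \<kappa> \<rho> \<longleftrightarrow>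
     (\<forall>\<gamma>\<in>SL2Z. \<rho> \<gamma> \<in> carrier_mat r r \<and> invertible_mat (\<rho> \<gamma>)) \<and>
     (\<forall>\<gamma>\<in>SL2Z. \<forall>\<gamma>'\<in>SL2Z. \<forall>\<tau>\<in>upper_half_plane.
        automorphy \<kappa> \<rho> (\<gamma> * \<gamma>') \<tau> = automorphy \<kappa> \<rho> \<gamma> (moebius \<gamma>' \<tau>) * automorphy \<kappa> \<rho> \<gamma>' \<tau>)"

definition unitary_multiplier :: "nat \<Rightarrow> (int mat \<Rightarrow> complex mat) \<Rightarrow> bool" where
  "unitary_multiplier r \<rho> \<longleftrightarrow> (\<forall>\<gamma>\<in>SL2Z. mat_adjoint (\<rho> \<gamma>) * \<rho> \<gamma> = 1\<^sub>m r)"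

definition q_pow :: "real \<Rightarrow> complex \<Rightarrow> complex" where
  "q_pow \<mu> \<tau> = exp (2 * of_real pi * \<i> * of_real \<mu> * \<tau>)"

definition exponents :: "real \<Rightarrow> real set" where
  "exponents \<alpha> = {\<mu>. \<mu> > 0 \<and> (\<exists>n::nat. \<mu> = \<alpha> + real n)}"

(* g is a cusp form of weight kappa and multiplier rho, with Fourier coefficients a, where
   (a mu) $ k is the coefficient of q^mu in g_k, and is 0 if mu is not an exponent of g_k. *)
definition cusp_form ::
    "nat \<Rightarrow> real \<Rightarrow> (int mat \<Rightarrow> complex mat) \<Rightarrow> (nat \<Rightarrow> real) \<Rightarrow>
     (complex \<Rightarrow> complex vec) \<Rightarrow> (real \<Rightarrow> complex vec) \<Rightarrow> bool" where
  "cusp_form r \<kappa> \<rho> \<alpha> g a \<longleftrightarrow>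
     (\<forall>\<tau>\<in>upper_half_plane. g \<tau> \<in> carrier_vec r) \<and>
     (\<forall>k<r. (\<lambda>\<tau>. g \<tau> $ k) holomorphic_on upper_half_plane) \<and>
     (\<forall>\<gamma>\<in>SL2Z. \<forall>\<tau>\<in>upper_half_plane.
        g (moebius \<gamma> \<tau>) = automorphy \<kappa> \<rho> \<gamma> \<tau> *\<^sub>v g \<tau>) \<and>
     (\<forall>\<mu>. a \<mu> \<in> carrier_vec r) \<and>
     (\<forall>k<r. \<forall>\<mu>. \<mu> \<notin> exponents (\<alpha> k) \<longrightarrow> a \<mu> $ k = 0) \<and>
     (\<forall>k<r. \<forall>\<tau>\<in>upper_half_plane.
        ((\<lambda>\<mu>. a \<mu> $ k * q_pow \<mu> \<tau>) has_sum (g \<tau> $ k)) (exponents (\<alpha> k))) \<and>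
     (\<forall>k<r. (\<lambda>\<mu>. cmod (a \<mu> $ k)) \<in> O(\<lambda>\<mu>. \<mu> powr (\<kappa> / 2)))"

definition common_denominator :: "nat \<Rightarrow> (nat \<Rightarrow> real) \<Rightarrow> nat" where
  "common_denominator r \<alpha> = (LEAST d. d > 0 \<and> (\<forall>k<r. real d * \<alpha> k \<in> \<int>))"

(* The sums over all positive reals are sums over the exponents, the coefficients being 0 elsewhere. *)
definition eichler_integral :: "nat \<Rightarrow> real \<Rightarrow> (real \<Rightarrow> complex vec) \<Rightarrow> complex \<Rightarrow> complex vec" where
  "eichler_integral r \<kappa> a \<tau> =
     vec r (\<lambda>k. \<Sum>\<^sub>\<infinity>\<mu>\<in>{0<..}. of_real (\<mu> powr (1 - \<kappa>)) * a \<mu> $ k * q_pow \<mu> \<tau>)"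

definition dirichlet_vec :: "nat \<Rightarrow> (real \<Rightarrow> complex vec) \<Rightarrow> complex \<Rightarrow> complex vec" where
  "dirichlet_vec r a s = vec r (\<lambda>k. \<Sum>\<^sub>\<infinity>\<mu>\<in>{0<..}. a \<mu> $ k * of_real \<mu> powr (- s))"

(* Asymptotic expansion as tau -> 0 in the upper half-plane, uniformly in every closed subsector
   (in general it fails on horocycles at 0, where Im (-1/tau) stays bounded). *)
definition asymptotic_expansion ::
    "nat \<Rightarrow> (complex \<Rightarrow> complex vec) \<Rightarrow> (nat \<Rightarrow> complex vec) \<Rightarrow> bool" where
  "asymptotic_expansion r f c \<longleftrightarrow>
     (\<forall>l. c l \<in> carrier_vec r) \<and>
     (\<forall>k<r. \<forall>N. \<forall>\<delta>>0.
        (\<lambda>\<tau>. f \<tau> $ k - (\<Sum>l<N. c l $ k * \<tau> ^ l))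
          \<in> O[at 0 within {\<tau>. Im \<tau> > 0 \<and> Im \<tau> \<ge> \<delta> * cmod \<tau>}](\<lambda>\<tau>. \<tau> ^ N))"

definition borel_monomial :: "real \<Rightarrow> complex \<Rightarrow> complex" where
  "borel_monomial p \<xi> = \<xi> powr of_real (p - 1) / Gamma (of_real p)"

(* B is the Borel transform of tau^p * (sum over l of c_l * tau^l): the termwise transform near the
   origin, continued to the domain U with the multivalued factor xi^(p-1) split off, the factor
   itself being taken with the principal branch. *)
definition borel_transform ::
    "nat \<Rightarrow> real \<Rightarrow> (nat \<Rightarrow> complex vec) \<Rightarrow> complex set \<Rightarrow> (complex \<Rightarrow> complex vec) \<Rightarrow> bool" where
  "borel_transform r p c U B \<longleftrightarrow>
     open U \<and> connected U \<and> 0 \<in> U \<and> (\<forall>\<xi>. B \<xi> \<in> carrier_vec r) \<and>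
     (\<forall>k<r.
        (\<forall>\<^sub>F \<xi> in at 0. (\<lambda>l. c l $ k * borel_monomial (p + real l) \<xi>) sums (B \<xi> $ k)) \<and>
        (\<exists>F. F holomorphic_on U \<and> (\<forall>\<xi>\<in>U - {0}. B \<xi> $ k = \<xi> powr of_real (p - 1) * F \<xi>)))"

definition stokes_point :: "real \<Rightarrow> complex" where
  "stokes_point \<mu> = 2 * of_real pi * \<i> * of_real \<mu>"

end

theory Submission
  imports Defs
begin

text \<open>
  The whole theorem is extracted from the inversion \<open>\<tau> \<mapsto> - 1 / \<tau>\<close>. Combined with the Fourier expansion
  it shows that in every sector \<open>Im \<tau> \<ge> \<delta> \<bar>\<tau>\<bar>\<close> the components of \<open>g\<close> decay faster than every power of
  \<open>\<bar>\<tau>\<bar>\<close>, both at infinity and at 0 (lemma \<open>fourier_rapid\<close>), and Cauchy's inequality passes this on to all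
  derivatives. For a function \<open>f\<close> of this kind let \<open>M(f, \<tau>, s)\<close> be the integral of
  \<open>f (\<tau> + \<i> t) t^(s - 1) dt\<close> over \<open>t > 0\<close>. It converges for \<open>\<tau> = 0\<close> and all \<open>s\<close>, and for \<open>\<tau>\<close> in the
  upper half-plane and \<open>s = 1/2\<close>, and these values carry all the information.

  The entire function \<open>\<Lambda>\<close> is \<open>M(g, 0, s)\<close>. Termwise integration identifies it with the completed Dirichlet
  vector, and \<open>t \<mapsto> 1 / t\<close> gives its functional equation.

  Write \<open>\<kappa> = 3/2 - n\<close> with \<open>n\<close> equal to 0 or 1. As \<open>\<mu>^(1 - \<kappa>) = \<mu>^n \<mu>^(- 1/2)\<close> and \<open>\<mu>^(- 1/2)\<close> is a
  Gamma integral, the Eichler integral is a multiple of \<open>M(f, \<tau>, 1/2)\<close> for the \<open>n\<close>-th derivative \<open>f\<close> of \<open>g\<close>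
  (lemma \<open>eichler_eq_vmellin\<close>). Taylor's formula under the integral sign yields the asymptotic expansion;
  its coefficient \<open>c l\<close> is the same multiple of \<open>M(h, 0, 1/2) / l!\<close>, where \<open>h\<close> is the derivative of \<open>g\<close> of
  order \<open>n + l\<close> (lemma \<open>vmellin_taylor\<close>). Integration by parts and the functional equation convert this
  into a multiple of \<open>\<rho>(S) \<Lambda>(1 + l)\<close>, and for \<open>l \<ge> 1\<close> the Dirichlet series converges absolutely at
  \<open>1 + l\<close>. The Pochhammer symbol that arises cancels against the Gamma value in the Borel transform, and
  there remains
  \<open>c l / Gamma (2 - \<kappa> + l) = K (2 \<pi> \<i>)^(- l) \<rho>(S) (\<Sum>\<mu>. a \<mu> \<mu>^(- 1 - l))\<close>
  with a scalar \<open>K \<noteq> 0\<close> depending only on \<open>\<kappa>\<close> (lemma \<open>asymptotic_coeff_eq\<close>).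

  Summation over \<open>l\<close> is a geometric series. Hence the Borel transform is \<open>\<xi>^(1 - \<kappa>)\<close> times a constant
  vector plus \<open>K (\<Sum>\<mu>. \<rho>(S) a \<mu> (1 / (\<mu> - w) - 1 / \<mu>))\<close> with \<open>w = \<xi> / (2 \<pi> \<i>)\<close>. This is a partial
  fraction series, from which the continuation, the simple poles at \<open>2 \<pi> \<i> \<mu>\<close> and their residues are read
  off; the coefficient with \<open>l = 0\<close>, where the Dirichlet series need not converge absolutely, enters
  the constant vector only. Up to a constant, the Stokes vectors are \<open>\<mu>^(1 - \<kappa>) \<rho>(S) a \<mu>\<close>, and
  their Dirichlet series is a shift of that of \<open>\<rho>(S) a\<close>.
\<close>

section \<open>Functions of rapid decay in sectors\<close>

lemma integrable_exp_neg_abs: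
  fixes a :: real
  assumes a: "a > 0"
  shows "integrable lborel (\<lambda>x::real. exp (- a * \<bar>x\<bar>))"
proof -
  have "(\<lambda>x. exp (- a * x)) absolutely_integrable_on {0..}"
    using a by (intro nonnegative_absolutely_integrable_1 integrable_on_exp_minus_to_infinity) auto
  then have i: "integrable lborel (\<lambda>x. indicator {0..} x * exp (- a * x))"
    by (simp add: set_integrable_def integrable_completion)
  have "integrable lborel (\<lambda>x. indicator {0..} (0 + - 1 * x) * exp (- a * (0 + - 1 * x)))"
    by (rule lborel_integrable_real_affine[OF i]) simp
  from Bochner_Integration.integrable_add[OF i this]
  show ?thesis
    by (rule Bochner_Integration.integrable_bound) (auto simp: indicator_def)
qed

text \<open>
  With the substitution \<open>t = exp x\<close> all integrals over \<open>t > 0\<close> become integrals over the whole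
  line, and \<open>exp (- a * \<bar>x\<bar>)\<close> is the majorant that serves for all of them.
\<close>
lemma integrable_exp_dominated:
  fixes f :: "real \<Rightarrow> complex"
  assumes f: "continuous_on UNIV f" and a: "a > 0"
    and le: "\<And>x. cmod (f x) \<le> C * exp (- a * \<bar>x\<bar>)"
  shows "integrable lborel f"
    and "cmod (LINT x|lborel. f x) \<le> C * (LINT x|lborel. exp (- a * \<bar>x\<bar>))"
proof -
  have b: "integrable lborel (\<lambda>x. C * exp (- a * \<bar>x\<bar>))"
    using integrable_exp_neg_abs[OF a] by simp
  show i: "integrable lborel f"
    by (rule Bochner_Integration.integrable_bound[OF b])
       (use le f in \<open>auto intro!: borel_measurable_continuous_onI order_trans[OF le]\<close>)
  have "cmod (LINT x|lborel. f x) \<le> (LINT x|lborel. C * exp (- a * \<bar>x\<bar>))"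
    by (rule Bochner_Integration.integral_norm_bound_integral[OF i b le])
  then show "cmod (LINT x|lborel. f x) \<le> C * (LINT x|lborel. exp (- a * \<bar>x\<bar>))" by simp
qed

definition half_sector :: "real \<Rightarrow> complex set" where
  "half_sector \<delta> = {z. 0 < Im z \<and> \<delta> * cmod z \<le> Im z}"

text \<open>
  As \<open>p\<close> is an arbitrary real number, the bound expresses decay faster than every power both at 0
  (take \<open>p\<close> large) and at infinity (take \<open>p\<close> very negative).
\<close>
definition rapid :: "(complex \<Rightarrow> complex) \<Rightarrow> bool" where
  "rapid f \<longleftrightarrow> f holomorphic_on upper_half_plane \<and>
     (\<forall>\<delta>>0. \<forall>p. \<exists>C. \<forall>z\<in>half_sector \<delta>. cmod (f z) \<le> C * cmod z powr p)"

lemma open_upper_half_plane: "open upper_half_plane"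
  unfolding upper_half_plane_def by (rule open_halfspace_Im_gt)

lemma rapid_bound:
  assumes "rapid f" "\<delta> > 0"
  obtains C where "C \<ge> 0" "\<And>z. z \<in> half_sector \<delta> \<Longrightarrow> cmod (f z) \<le> C * cmod z powr p"
proof -
  obtain C where C: "\<forall>z\<in>half_sector \<delta>. cmod (f z) \<le> C * cmod z powr p"
    using assms unfolding rapid_def by blast
  have "cmod (f z) \<le> \<bar>C\<bar> * cmod z powr p" if "z \<in> half_sector \<delta>" for z
    using C that by (meson abs_ge_self mult_right_mono order_trans powr_ge_zero)
  then show ?thesis using that[of "\<bar>C\<bar>"] by auto
qed

text \<open>
  Cauchy's inequality on a disc around \<open>z\<close> with radius proportional to \<open>\<bar>z\<bar>\<close>: the disc stays in a
  slightly wider sector and in the range where \<open>\<bar>w\<bar>\<close> is comparable with \<open>\<bar>z\<bar>\<close>. The factor \<open>1 / \<bar>z\<bar>\<close>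
  that is lost does no harm, because the exponent is arbitrary.
\<close>
lemma rapid_deriv:
  assumes f: "rapid f"
  shows "rapid (deriv f)"
  unfolding rapid_def
proof (intro conjI allI impI)
  have hol: "f holomorphic_on upper_half_plane" using f by (simp add: rapid_def)
  show "deriv f holomorphic_on upper_half_plane"
    by (rule holomorphic_deriv[OF hol open_upper_half_plane])
  fix \<delta> p :: real assume \<delta>: "\<delta> > 0"
  \<comment> \<open>Used both as the relative radius of the discs and as the constant of the wider sector.\<close>
  define e where "e = min (\<delta> / 4) (1/2)"
  have e: "0 < e" "e \<le> \<delta> / 4" "e \<le> 1/2" using \<delta> by (auto simp: e_def)
  obtain C where C0: "C \<ge> 0" and C: "\<And>z. z \<in> half_sector e \<Longrightarrow> cmod (f z) \<le> C * cmod z powr (p+1)"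
    using rapid_bound[OF f e(1)] by blast
  show "\<exists>C. \<forall>z\<in>half_sector \<delta>. cmod (deriv f z) \<le> C * cmod z powr p"
  proof (intro exI ballI)
    fix z assume z: "z \<in> half_sector \<delta>"
    then have z0: "cmod z > 0" and Imz: "\<delta> * cmod z \<le> Im z" "Im z > 0"
      by (auto simp: half_sector_def)
    define r where "r = e * cmod z"
    have r: "r > 0" using e z0 by (simp add: r_def)
    have near: "w \<in> half_sector e \<and> cmod w \<le> 2 * cmod z \<and> cmod z / 2 \<le> cmod w"
      if "cmod (z - w) \<le> r" for w
    proof -
      have "\<bar>cmod z - cmod w\<bar> \<le> r" using that norm_triangle_ineq3[of z w] by linarith
      moreover have r2: "r \<le> cmod z / 2" using e z0 by (simp add: r_def)
      ultimately have w: "cmod w \<le> 2 * cmod z" "cmod z / 2 \<le> cmod w" by linarith+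
      have "Im z - Im w \<le> r" using that abs_Im_le_cmod[of "z - w"] by simp
      moreover have "r \<le> \<delta>/4 * cmod z" unfolding r_def using e z0 by (intro mult_right_mono) auto
      ultimately have "Im w \<ge> (\<delta> - \<delta>/4) * cmod z" using Imz by (simp add: algebra_simps)
      moreover have "e * cmod w \<le> \<delta>/4 * (2 * cmod z)"
        using e w \<delta> by (intro mult_mono) auto
      moreover have "\<delta> * cmod z > 0" using \<delta> z0 by simp
      ultimately show ?thesis using w by (simp add: half_sector_def algebra_simps)
    qed
    have sub: "cball z r \<subseteq> upper_half_plane"
      using near by (auto simp: dist_norm half_sector_def upper_half_plane_def)
    have "cmod (f w) \<le> C * (2 powr \<bar>p+1\<bar> * cmod z powr (p+1))" if "norm (z - w) = r" for w
    proof -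
      have w: "w \<in> half_sector e" "cmod w \<le> 2 * cmod z" "cmod z / 2 \<le> cmod w"
        using near[of w] that by auto
      have "cmod w powr (p+1) \<le> 2 powr \<bar>p+1\<bar> * cmod z powr (p+1)"
      proof (cases "p + 1 \<ge> 0")
        case True
        then have "cmod w powr (p+1) \<le> (2 * cmod z) powr (p+1)" using w by (intro powr_mono2) auto
        then show ?thesis using True z0 by (simp add: powr_mult)
      next
        case False
        then have "cmod w powr (p+1) \<le> (cmod z / 2) powr (p+1)"
          using w z0 by (intro powr_mono2') auto
        also have "\<dots> = 2 powr (- (p+1)) * cmod z powr (p+1)"
            unfolding powr_divide powr_minus by (simp add: field_simps)
          finally show ?thesis using False by simp
      qed
      then show ?thesis using C[OF w(1)] C0 by (meson mult_left_mono order_trans)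
    qed
    then have "norm ((deriv ^^ 1) f z) \<le> fact 1 * (C * (2 powr \<bar>p+1\<bar> * cmod z powr (p+1))) / r ^ 1"
      using sub hol r
      by (intro Cauchy_inequality)
         (auto intro!: holomorphic_on_imp_continuous_on elim!: holomorphic_on_subset
            dest: subsetD[OF ball_subset_cball])
    also have "\<dots> = (C * 2 powr \<bar>p+1\<bar> / e) * cmod z powr p"
      using z0 by (simp add: r_def powr_add field_simps)
    finally show "cmod (deriv f z) \<le> (C * 2 powr \<bar>p+1\<bar> / e) * cmod z powr p" by simp
  qed
qed

lemma rapid_higher_deriv: "rapid f \<Longrightarrow> rapid ((deriv ^^ n) f)"
  by (induction n) (auto intro: rapid_deriv)

lemma rapid_axis_bound:
  assumes "rapid f"
  obtains C where "C \<ge> 0" "\<And>x. cmod (f (\<i> * of_real (exp x))) \<le> C * exp (- A * \<bar>x\<bar>)"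
proof -
  have s: "\<i> * of_real (exp x) \<in> half_sector 1" for x by (simp add: half_sector_def norm_mult)
  obtain C1 where C1: "C1 \<ge> 0" "\<And>z. z \<in> half_sector 1 \<Longrightarrow> cmod (f z) \<le> C1 * cmod z powr A"
    using rapid_bound[OF assms, of 1] by auto
  obtain C2 where C2: "C2 \<ge> 0" "\<And>z. z \<in> half_sector 1 \<Longrightarrow> cmod (f z) \<le> C2 * cmod z powr (-A)"
    using rapid_bound[OF assms, of 1] by auto
  have "cmod (f (\<i> * of_real (exp x))) \<le> (C1 + C2) * exp (- A * \<bar>x\<bar>)" for x
  proof (cases "x \<ge> 0")
    case True
    then have "cmod (f (\<i> * of_real (exp x))) \<le> C2 * exp (- A * \<bar>x\<bar>)"
      using C2(2)[OF s[of x]] by (simp add: norm_mult powr_def)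
    also have "\<dots> \<le> (C1 + C2) * exp (- A * \<bar>x\<bar>)" using C1 by (intro mult_right_mono) auto
    finally show ?thesis .
  next
    case False
    then have "cmod (f (\<i> * of_real (exp x))) \<le> C1 * exp (- A * \<bar>x\<bar>)"
      using C1(2)[OF s[of x]] by (simp add: norm_mult powr_def)
    also have "\<dots> \<le> (C1 + C2) * exp (- A * \<bar>x\<bar>)" using C2 by (intro mult_right_mono) auto
    finally show ?thesis .
  qed
  then show ?thesis using that[of "C1 + C2"] C1 C2 by auto
qed

text \<open>
  The weight \<open>exp (x / 2)\<close> is the square root of \<open>t = exp x\<close>, which is integrable against \<open>dt / t\<close> near
  \<open>t = 0\<close>, so that boundedness of \<open>f\<close> is enough there; for large \<open>t\<close> a bound \<open>C / \<bar>z\<bar> \<le> C / t\<close> is enough.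
  Uniformity in \<open>z\<close> makes the bound applicable to all points of a Taylor remainder at once.
\<close>
lemma rapid_ray_bound:
  assumes "rapid f" "\<delta> > 0"
  obtains C where "C \<ge> 0"
    "\<And>z x. z \<in> half_sector \<delta> \<Longrightarrow> exp x \<le> Im z \<Longrightarrow> cmod (f z) * exp (x / 2) \<le> C * exp (- (1/2) * \<bar>x\<bar>)"
proof -
  obtain C1 where C1: "C1 \<ge> 0" "\<And>z. z \<in> half_sector \<delta> \<Longrightarrow> cmod (f z) \<le> C1 * cmod z powr 0"
    using rapid_bound[OF assms] by blast
  obtain C2 where C2: "C2 \<ge> 0" "\<And>z. z \<in> half_sector \<delta> \<Longrightarrow> cmod (f z) \<le> C2 * cmod z powr (-1)"
    using rapid_bound[OF assms] by blast
  have "cmod (f z) * exp (x / 2) \<le> (C1 + C2) * exp (- (1/2) * \<bar>x\<bar>)"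
    if z: "z \<in> half_sector \<delta>" and x: "exp x \<le> Im z" for z x
  proof -
    have zx: "exp x \<le> cmod z" using x abs_Im_le_cmod[of z] by linarith
    have z0: "cmod z > 0" using zx exp_gt_zero[of x] by linarith
    show ?thesis
    proof (cases "x \<ge> 0")
      case True
      have "cmod z powr (-1) \<le> exp x powr (-1)" using zx by (intro powr_mono2') auto
      then have "cmod (f z) \<le> C2 * exp (- x)"
        using C2(2)[OF z] C2(1) by (metis exp_powr_real mult.commute mult_left_mono mult_minus1 order_trans)
      then have "cmod (f z) * exp (x/2) \<le> C2 * exp (- x) * exp (x/2)" by (intro mult_right_mono) auto
      also have "\<dots> = C2 * exp (- (1/2) * \<bar>x\<bar>)" using True by (simp add: mult.assoc flip: exp_add)
      also have "\<dots> \<le> (C1 + C2) * exp (- (1/2) * \<bar>x\<bar>)" using C1 by (intro mult_right_mono) auto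
      finally show ?thesis .
    next
      case False
      have "cmod (f z) * exp (x/2) \<le> C1 * exp (x/2)"
        using C1(2)[OF z] z0 by (intro mult_right_mono) auto
      also have "\<dots> \<le> (C1 + C2) * exp (- (1/2) * \<bar>x\<bar>)" using False C2
        by (simp add: distrib_right)
      finally show ?thesis .
    qed
  qed
  then show ?thesis using that[of "C1 + C2"] C1 C2 by auto
qed

section \<open>Mellin transforms along vertical rays\<close>

text \<open>
  This is the integral of \<open>f (\<tau> + \<i> t) t^(s - 1) dt\<close> over \<open>t > 0\<close>, with \<open>t = exp x\<close>. In the variable
  \<open>x\<close> the inversion of \<open>t\<close> is a reflection and the scaling of \<open>t\<close> is a translation.
\<close>
definition vmellin :: "(complex \<Rightarrow> complex) \<Rightarrow> complex \<Rightarrow> complex \<Rightarrow> complex" where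
  "vmellin f \<tau> s = (LINT x|lborel. f (\<tau> + \<i> * of_real (exp x)) * exp (s * of_real x))"

lemma continuous_vmellin:
  assumes "f holomorphic_on upper_half_plane" "Im \<tau> \<ge> 0"
  shows "continuous_on UNIV (\<lambda>x. f (\<tau> + \<i> * of_real (exp x)) * exp (s * of_real x))"
proof -
  have "continuous_on UNIV (\<lambda>x. f (\<tau> + \<i> * of_real (exp x)))"
    by (rule continuous_on_compose2[OF holomorphic_on_imp_continuous_on[OF assms(1)]])
       (use assms(2) in \<open>auto intro!: continuous_intros simp: upper_half_plane_def add_nonneg_pos\<close>)
  then show ?thesis by (intro continuous_intros)
qed

lemma norm_exp_of_real_mult: "cmod (exp (s * of_real x)) \<le> exp (\<bar>Re s\<bar> * \<bar>x\<bar>)"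
proof -
  have "Re s * x \<le> \<bar>Re s\<bar> * \<bar>x\<bar>" by (metis abs_ge_self abs_mult)
  then show ?thesis by simp
qed

lemma rapid_mellin_bound:
  assumes "rapid f"
  obtains C where "C \<ge> 0"
    "\<And>x. cmod (f (\<i> * of_real (exp x)) * exp (s * of_real x)) \<le> C * exp (- A * \<bar>x\<bar>)"
proof -
  obtain C where C: "C \<ge> 0" "\<And>x. cmod (f (\<i> * of_real (exp x))) \<le> C * exp (- (A + \<bar>Re s\<bar>) * \<bar>x\<bar>)"
    using rapid_axis_bound[OF assms, of "A + \<bar>Re s\<bar>"] by blast
  have "cmod (f (\<i> * of_real (exp x)) * exp (s * of_real x)) \<le> C * exp (- A * \<bar>x\<bar>)" for x
  proof -
    have "cmod (f (\<i> * of_real (exp x)) * exp (s * of_real x))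
        \<le> (C * exp (- (A + \<bar>Re s\<bar>) * \<bar>x\<bar>)) * exp (\<bar>Re s\<bar> * \<bar>x\<bar>)"
      unfolding norm_mult using C by (intro mult_mono norm_exp_of_real_mult) auto
    also have "\<dots> = C * exp (- A * \<bar>x\<bar>)"
      by (simp add: mult.assoc distrib_right left_diff_distrib flip: exp_add)
    finally show ?thesis .
  qed
  then show ?thesis using that C(1) by blast
qed

lemma vmellin_0_integrable:
  assumes "rapid f"
  shows "integrable lborel (\<lambda>x. f (\<i> * of_real (exp x)) * exp (s * of_real x))"
proof -
  obtain C where "\<And>x. cmod (f (\<i> * of_real (exp x)) * exp (s * of_real x)) \<le> C * exp (- 1 * \<bar>x\<bar>)"
    using rapid_mellin_bound[OF assms] by blast
  then show ?thesis
    using continuous_vmellin[of f 0 s] assms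
    by (intro integrable_exp_dominated(1)[of _ 1 C]) (auto simp: rapid_def)
qed

lemma norm_exp_minus_1_le: "cmod (exp w - 1) \<le> exp (cmod w) * cmod w"
proof -
  have "cmod (exp w - exp 0) \<le> exp (cmod w) * cmod (w - 0)"
  proof (rule field_differentiable_bound[where S = "cball 0 (cmod w)" and f' = exp])
    show "cmod (exp z) \<le> exp (cmod w)" if "z \<in> cball 0 (cmod w)" for z
      using that complex_Re_le_cmod[of z] by auto
  qed (auto intro: DERIV_exp DERIV_subset)
  then show ?thesis by simp
qed

text \<open>
  Differentiation under the integral sign: for \<open>\<bar>h\<bar> \<le> 1\<close> the difference quotient of \<open>exp (s x)\<close> in \<open>s\<close> is
  at most \<open>exp (2 \<bar>x\<bar>)\<close> times \<open>\<bar>exp (s x)\<bar>\<close>, and rapid decay of \<open>f\<close> absorbs any exponential in \<open>\<bar>x\<bar>\<close>.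
\<close>
lemma vmellin_entire:
  assumes "rapid f"
  shows "(\<lambda>s. vmellin f 0 s) holomorphic_on UNIV"
proof -
  have "((\<lambda>s. vmellin f 0 s) has_field_derivative
      (LINT x|lborel. f (\<i> * of_real (exp x)) * exp (s * of_real x) * of_real x)) (at s)" for s
  proof -
    define u where "u = (\<lambda>x. f (\<i> * of_real (exp x)) * exp (s * of_real x))"
    define q where "q = (\<lambda>h x. (exp (h * complex_of_real x) - 1) / h)"
    obtain C where C: "C \<ge> 0" "\<And>x. cmod (u x) \<le> C * exp (- 3 * \<bar>x\<bar>)"
      using rapid_mellin_bound[OF assms, of s 3] unfolding u_def by blast
    have cu: "continuous_on UNIV u"
      unfolding u_def using continuous_vmellin[of f 0 s] assms by (simp add: rapid_def)
    have diff: "(vmellin f 0 (s + h) - vmellin f 0 s) / h = (LINT x|lborel. u x * q h x)" for h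
    proof -
      let ?d = "\<lambda>x. f (\<i> * of_real (exp x)) * exp ((s + h) * of_real x) -
                          f (\<i> * of_real (exp x)) * exp (s * of_real x)"
      have "vmellin f 0 (s + h) - vmellin f 0 s = (LINT x|lborel. ?d x)"
        unfolding vmellin_def
        using Bochner_Integration.integral_diff[OF vmellin_0_integrable[OF assms, of "s + h"]
            vmellin_0_integrable[OF assms, of s]] by simp
      then have "(vmellin f 0 (s + h) - vmellin f 0 s) / h = (LINT x|lborel. ?d x) / h" by simp
      also have "\<dots> = (LINT x|lborel. ?d x / h)"
        by (rule integral_divide_zero[symmetric])
      also have "\<dots> = (LINT x|lborel. u x * q h x)"
      proof (rule Bochner_Integration.integral_cong[OF refl])
        fix x :: real
        have "exp ((s + h) * of_real x) = exp (s * of_real x) * exp (h * complex_of_real x)"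
          unfolding distrib_right by (rule exp_add)
        then show "(f (\<i> * of_real (exp x)) * exp ((s + h) * of_real x) -
                  f (\<i> * of_real (exp x)) * exp (s * of_real x)) / h = u x * q h x"
          unfolding u_def q_def by (simp add: right_diff_distrib)
      qed
      finally show ?thesis .
    qed
    have "((\<lambda>h. LINT x|lborel. u x * q h x) \<longlongrightarrow> (LINT x|lborel. u x * of_real x)) (at 0 within ball 0 1)"
      unfolding tendsto_at_iff_sequentially
    proof (intro allI impI)
      fix X :: "nat \<Rightarrow> complex" assume X: "\<forall>i. X i \<in> ball 0 1 - {0}" "X \<longlonglongrightarrow> 0"
      show "((\<lambda>h. LINT x|lborel. u x * q h x) \<circ> X) \<longlonglongrightarrow> (LINT x|lborel. u x * of_real x)"
        unfolding comp_def
      proof (rule integral_dominated_convergence[where w = "\<lambda>x. C * exp (- 1 * \<bar>x\<bar>)"])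
        show "(\<lambda>x. u x * complex_of_real x) \<in> borel_measurable lborel"
          using cu by (auto intro!: borel_measurable_continuous_onI continuous_intros)
        show "(\<lambda>x. u x * q (X i) x) \<in> borel_measurable lborel" for i
          unfolding q_def using cu X
          by (auto intro!: borel_measurable_continuous_onI continuous_intros)
        show "integrable lborel (\<lambda>x::real. C * exp (- 1 * \<bar>x\<bar>))"
          using integrable_exp_neg_abs[of 1] by simp
        show "AE x in lborel. (\<lambda>i. u x * q (X i) x) \<longlonglongrightarrow> u x * complex_of_real x"
        proof (intro AE_I2 tendsto_intros)
          fix x :: real
          have "((\<lambda>h. exp (h * complex_of_real x)) has_field_derivative of_real x) (at 0)"
            by (auto intro!: derivative_eq_intros)
          then have "((\<lambda>h. q h x) \<longlongrightarrow> of_real x) (at 0)"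
            unfolding DERIV_def q_def by simp
          then show "(\<lambda>i. q (X i) x) \<longlonglongrightarrow> complex_of_real x"
            using X unfolding tendsto_at_iff_sequentially by (auto simp: comp_def)
        qed
        show "AE x in lborel. cmod (u x * q (X i) x) \<le> C * exp (- 1 * \<bar>x\<bar>)" for i
        proof (rule AE_I2)
          fix x :: real
          have h: "X i \<noteq> 0" "cmod (X i) \<le> 1" using X by (auto simp: less_imp_le)
          have "cmod (exp (X i * of_real x) - 1) \<le> exp (cmod (X i * of_real x)) * cmod (X i * of_real x)"
            by (rule norm_exp_minus_1_le)
          then have "cmod (q (X i) x) \<le> exp (cmod (X i) * \<bar>x\<bar>) * \<bar>x\<bar>"
            using h by (simp add: q_def norm_divide norm_mult field_simps)
          also have "\<dots> \<le> exp \<bar>x\<bar> * exp \<bar>x\<bar>"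
          proof (intro mult_mono)
            show "\<bar>x\<bar> \<le> exp \<bar>x\<bar>" using exp_ge_add_one_self[of "\<bar>x\<bar>"] by linarith
          qed (use h in \<open>auto simp: mult_left_le_one_le\<close>)
          finally have "cmod (u x * q (X i) x) \<le> (C * exp (- 3 * \<bar>x\<bar>)) * (exp \<bar>x\<bar> * exp \<bar>x\<bar>)"
            unfolding norm_mult using C by (intro mult_mono) auto
          then show "cmod (u x * q (X i) x) \<le> C * exp (- 1 * \<bar>x\<bar>)"
            by (simp add: mult.assoc flip: exp_add)
        qed
      qed
    qed
    moreover have "at (0::complex) within ball 0 1 = at 0" by (rule at_within_open) auto
    ultimately show ?thesis unfolding DERIV_def diff by (simp add: u_def)
  qed
  then show ?thesis by (auto simp: holomorphic_on_def field_differentiable_def intro: DERIV_subset)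
qed

text \<open>
  Integration by parts. The boundary terms vanish for every \<open>s\<close>, whatever its real part, because \<open>f\<close>
  decays rapidly at both ends of the imaginary axis.
\<close>
lemma vmellin_deriv:
  assumes "rapid f"
  shows "vmellin (deriv f) 0 (s + 1) = \<i> * s * vmellin f 0 s"
proof -
  note d = rapid_deriv[OF assms]
  have hol: "f holomorphic_on upper_half_plane" "deriv f holomorphic_on upper_half_plane"
    using assms d by (auto simp: rapid_def)
  define F where "F = (\<lambda>x. f (\<i> * of_real (exp x)) * exp (s * of_real x))"
  define F' where "F' = (\<lambda>x. \<i> * (deriv f (\<i> * of_real (exp x)) * exp ((s + 1) * of_real x))
                       + s * (f (\<i> * of_real (exp x)) * exp (s * of_real x)))"
  have int: "integrable lborel F'"
    unfolding F'_def
    by (intro Bochner_Integration.integrable_add integrable_mult_right vmellin_0_integrable assms d)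
  have cont: "continuous_on UNIV F'"
    unfolding F'_def using continuous_vmellin[OF hol(1), of 0 s] continuous_vmellin[OF hol(2), of 0 "s+1"]
    by (intro continuous_on_add continuous_on_mult[OF continuous_on_const]) auto
  obtain C where C: "C \<ge> 0" "\<And>x. cmod (F x) \<le> C * exp (- 1 * \<bar>x\<bar>)"
    using rapid_mellin_bound[OF assms, of s 1] unfolding F_def by blast
  have deriv: "(F has_vector_derivative F' x) (at x)" for x
  proof -
    have "((\<lambda>x. \<i> * complex_of_real (exp x)) has_vector_derivative \<i> * of_real (exp x)) (at x)"
      by (intro has_vector_derivative_mult_right has_vector_derivative_of_real DERIV_exp)
    moreover have "(f has_field_derivative deriv f (\<i> * of_real (exp x))) (at (\<i> * of_real (exp x)))"
      by (rule holomorphic_derivI[OF hol(1) open_upper_half_plane]) (simp add: upper_half_plane_def)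
    ultimately have 1: "((\<lambda>x. f (\<i> * complex_of_real (exp x))) has_vector_derivative
        \<i> * of_real (exp x) * deriv f (\<i> * of_real (exp x))) (at x)"
      using field_vector_diff_chain_at by (fastforce simp: comp_def)
    have 2: "((\<lambda>x. exp (s * complex_of_real x)) has_vector_derivative s * exp (s * of_real x)) (at x)"
    proof -
      have "((\<lambda>x. s * complex_of_real x) has_vector_derivative s * of_real 1) (at x)"
        by (intro has_vector_derivative_mult_right has_vector_derivative_of_real DERIV_ident)
      from field_vector_diff_chain_at[OF this DERIV_exp] show ?thesis by (simp add: comp_def)
    qed
    from has_vector_derivative_mult[OF 1 2] show ?thesis
      unfolding F_def F'_def
      by (rule has_vector_derivative_eq_rhs) (simp add: exp_add exp_of_real algebra_simps)
  qed
  have lim: "(F \<longlongrightarrow> 0) at_top" "(F \<longlongrightarrow> 0) at_bot"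
  proof -
    have "filterlim (\<lambda>x::real. norm x) at_top at_infinity" by (rule filterlim_norm_at_top)
    then have "((\<lambda>x::real. C * exp (- 1 * \<bar>x\<bar>)) \<longlongrightarrow> 0) at_infinity"
      by (intro tendsto_mult_right_zero filterlim_compose[OF exp_at_bot])
         (simp add: filterlim_uminus_at_top[symmetric])
    then have "((\<lambda>x::real. C * exp (- 1 * \<bar>x\<bar>)) \<longlongrightarrow> 0) at_top"
        "((\<lambda>x::real. C * exp (- 1 * \<bar>x\<bar>)) \<longlongrightarrow> 0) at_bot"
      by (rule tendsto_mono[OF at_top_le_at_infinity], rule tendsto_mono[OF at_bot_le_at_infinity])
    then show "(F \<longlongrightarrow> 0) at_top" "(F \<longlongrightarrow> 0) at_bot"
      by (auto intro!: Lim_null_comparison[of F "\<lambda>x. C * exp (- 1 * \<bar>x\<bar>)"] always_eventually C)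
  qed
  have "(LBINT x=-\<infinity>..\<infinity>. F' x) = 0 - 0"
    using int cont lim deriv
    by (intro interval_integral_FTC_integrable[of _ _ F])
       (auto simp: ereal_tendsto_simps set_integrable_def continuous_on_eq_continuous_at)
  then have "0 = (LINT x|lborel. F' x)"
    by (simp add: interval_lebesgue_integral_def set_lebesgue_integral_def)
  also have "\<dots> = \<i> * vmellin (deriv f) 0 (s + 1) + s * vmellin f 0 s"
    unfolding F'_def vmellin_def
    using Bochner_Integration.integral_add[OF
        integrable_mult_right[OF vmellin_0_integrable[OF d, of "s + 1"], of \<i>]
        integrable_mult_right[OF vmellin_0_integrable[OF assms, of s], of s]] by simp
  finally have "\<i> * (\<i> * vmellin (deriv f) 0 (s + 1) + s * vmellin f 0 s) = 0" by simp
  then show ?thesis by (simp add: algebra_simps)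
qed

lemma vmellin_higher_deriv:
  assumes "rapid f"
  shows "vmellin ((deriv ^^ n) f) 0 (s + of_nat n) = \<i> ^ n * pochhammer s n * vmellin f 0 s"
proof (induction n)
  case (Suc n)
  have "vmellin ((deriv ^^ Suc n) f) 0 (s + of_nat (Suc n)) =
      vmellin (deriv ((deriv ^^ n) f)) 0 ((s + of_nat n) + 1)" by (simp add: algebra_simps)
  also have "\<dots> = \<i> * (s + of_nat n) * vmellin ((deriv ^^ n) f) 0 (s + of_nat n)"
    by (rule vmellin_deriv) (rule rapid_higher_deriv[OF assms])
  finally show ?case by (simp add: Suc.IH pochhammer_Suc algebra_simps)
qed simp

section \<open>Asymptotic expansion at the origin\<close>

lemma convex_half_sector:
  assumes d: "\<delta> \<ge> 0"
  shows "convex (half_sector \<delta> \<inter> {z. t \<le> Im z})"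
proof (intro convex_Int convex_halfspace_Im_ge convexI)
  fix z w u v assume z: "z \<in> half_sector \<delta>" "w \<in> half_sector \<delta>" and u: "0 \<le> u" "0 \<le> v" "u + v = (1::real)"
  have "cmod (u *\<^sub>R z + v *\<^sub>R w) \<le> u * cmod z + v * cmod w"
    using norm_triangle_ineq[of "u *\<^sub>R z" "v *\<^sub>R w"] u by simp
  then have "\<delta> * cmod (u *\<^sub>R z + v *\<^sub>R w) \<le> u * (\<delta> * cmod z) + v * (\<delta> * cmod w)"
    using d by (metis distrib_left mult.left_commute mult_left_mono)
  also have "\<dots> \<le> u * Im z + v * Im w"
    using z u by (intro add_mono mult_left_mono) (auto simp: half_sector_def)
  finally have 1: "\<delta> * cmod (u *\<^sub>R z + v *\<^sub>R w) \<le> Im (u *\<^sub>R z + v *\<^sub>R w)" by simp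
  have "u *\<^sub>R z + v *\<^sub>R w \<in> {z. 0 < Im z}"
    using z u convex_halfspace_Im_gt[of 0] unfolding convex_def half_sector_def by auto
  with 1 show "u *\<^sub>R z + v *\<^sub>R w \<in> half_sector \<delta>" by (simp add: half_sector_def)
qed

lemma half_sector_add_imaginary:
  assumes \<tau>: "\<tau> \<in> half_sector \<delta>" and \<delta>: "0 \<le> \<delta>" "\<delta> \<le> 1" and t: "t > 0"
  shows "\<tau> + \<i> * of_real t \<in> half_sector \<delta>"
proof -
  have "\<delta> * cmod (\<tau> + \<i> * of_real t) \<le> \<delta> * (cmod \<tau> + t)"
    using norm_triangle_ineq[of \<tau> "\<i> * of_real t"] \<delta> t
    by (intro mult_left_mono) (auto simp: norm_mult)
  also have "\<dots> = \<delta> * cmod \<tau> + \<delta> * t" by (simp add: distrib_left)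
  also have "\<dots> \<le> Im \<tau> + 1 * t"
    using \<tau> \<delta> t by (intro add_mono mult_right_mono) (auto simp: half_sector_def)
  finally show ?thesis using \<tau> t by (simp add: half_sector_def)
qed

text \<open>
  Taylor's formula cannot be used at 0, which lies on the boundary of the domain of \<open>f\<close>, but it can be
  used at each point \<open>\<i> t\<close>: the part of the sector above height \<open>t\<close> is convex and contains both \<open>\<i> t\<close> and
  \<open>\<tau> + \<i> t\<close>. The ray bound for the derivative of order \<open>N\<close> makes the remainders integrable in \<open>t\<close>. In
  this way the integral itself never has to be differentiated with respect to \<open>\<tau>\<close>.
\<close>
lemma vmellin_taylor:
  assumes f: "rapid f" and \<delta>: "\<delta> > 0"
  obtains C where "\<And>\<tau>. \<tau> \<in> half_sector \<delta> \<Longrightarrow>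
    cmod (vmellin f \<tau> (1/2) - (\<Sum>l<N. vmellin ((deriv ^^ l) f) 0 (1/2) / fact l * \<tau> ^ l)) \<le> C * cmod \<tau> ^ N"
proof (cases "\<delta> \<le> 1")
  case False
  have "\<tau> \<notin> half_sector \<delta>" for \<tau>
  proof
    assume "\<tau> \<in> half_sector \<delta>"
    then have *: "0 < Im \<tau>" "\<delta> * cmod \<tau> \<le> Im \<tau>" by (auto simp: half_sector_def)
    have "Im \<tau> \<le> cmod \<tau>" using abs_Im_le_cmod[of \<tau>] by linarith
    then have "1 * cmod \<tau> < \<delta> * cmod \<tau>" using False * by (intro mult_strict_right_mono) auto
    then show False using * \<open>Im \<tau> \<le> cmod \<tau>\<close> by linarith
  qed
  then show ?thesis using that by blast
next
  case \<delta>1: True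
  have hol: "(deriv ^^ l) f holomorphic_on upper_half_plane" for l
    using rapid_higher_deriv[OF f, of l] by (simp add: rapid_def)
  obtain C where C: "C \<ge> 0" "\<And>z x. z \<in> half_sector \<delta> \<Longrightarrow> exp x \<le> Im z \<Longrightarrow>
      cmod ((deriv ^^ N) f z) * exp (x / 2) \<le> C * exp (- (1/2) * \<bar>x\<bar>)"
    using rapid_ray_bound[OF rapid_higher_deriv[OF f] \<delta>] by blast
  let ?I = "LINT x|lborel. exp (- (1/2) * \<bar>x :: real\<bar>)"
  show ?thesis
  proof (rule that)
    fix \<tau> assume \<tau>: "\<tau> \<in> half_sector \<delta>"
    define g where "g = (\<lambda>l x. (deriv ^^ l) f (\<i> * of_real (exp x)) * exp ((1/2) * complex_of_real x))"
    define d where "d = (\<lambda>x. f (\<tau> + \<i> * of_real (exp x)) * exp ((1/2) * complex_of_real x)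
                            - (\<Sum>l<N. g l x / fact l * \<tau> ^ l))"
    have gint: "integrable lborel (g l)" for l
      unfolding g_def by (intro vmellin_0_integrable rapid_higher_deriv f)
    have gcont: "continuous_on UNIV (g l)" for l
      unfolding g_def using continuous_vmellin[OF hol, of 0 l "1/2"] by simp
    have fcont: "continuous_on UNIV (\<lambda>x. f (\<tau> + \<i> * of_real (exp x)) * exp ((1/2) * complex_of_real x))"
      using continuous_vmellin[OF hol[of 0], of \<tau> "1/2"] \<tau> by (simp add: half_sector_def)
    have dcont: "continuous_on UNIV d"
      unfolding d_def
      by (intro continuous_on_diff fcont continuous_on_sum continuous_on_mult continuous_on_divide
          gcont continuous_on_const) auto
    have dle: "cmod (d x) \<le> (C * cmod \<tau> ^ N) * exp (- (1/2) * \<bar>x\<bar>)" for x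
    proof -
      define S where "S = half_sector \<delta> \<inter> {z. exp x \<le> Im z}"
      have ix: "\<i> * of_real (exp x) \<in> S" using \<delta>1 by (simp add: S_def half_sector_def norm_mult)
      have tx: "\<tau> + \<i> * of_real (exp x) \<in> S"
        using half_sector_add_imaginary[OF \<tau> _ \<delta>1, of "exp x"] \<tau> \<delta> by (simp add: S_def half_sector_def)
      define B where "B = C * exp (- (1/2) * \<bar>x\<bar>) / exp (x / 2)"
      have B: "cmod ((deriv ^^ N) f z) \<le> B" if "z \<in> S" for z
        using C(2)[of z x] that by (simp add: S_def B_def field_simps)
      have B0: "B \<ge> 0" using C(1) by (simp add: B_def)
      have deq: "d x = (f (\<tau> + \<i> * of_real (exp x)) -
          (\<Sum>l<N. (deriv ^^ l) f (\<i> * of_real (exp x)) * \<tau> ^ l / fact l)) * exp ((1/2) * complex_of_real x)"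
        unfolding d_def g_def left_diff_distrib sum_distrib_right
        by (simp add: mult.commute mult.left_commute)
      have "cmod (f (\<tau> + \<i> * of_real (exp x)) -
          (\<Sum>l<N. (deriv ^^ l) f (\<i> * of_real (exp x)) * \<tau> ^ l / fact l)) \<le> B * cmod \<tau> ^ N"
      proof (cases N)
        case 0
        then show ?thesis using B[OF tx] by simp
      next
        case (Suc n)
        have "cmod ((deriv ^^ 0) f (\<tau> + \<i> * of_real (exp x)) -
          (\<Sum>l\<le>n. (deriv ^^ l) f (\<i> * of_real (exp x)) * (\<tau> + \<i> * of_real (exp x) - \<i> * of_real (exp x)) ^ l / fact l))
           \<le> B * cmod (\<tau> + \<i> * of_real (exp x) - \<i> * of_real (exp x)) ^ Suc n / fact n"
        proof (rule complex_Taylor[where S = S])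
          show "convex S" unfolding S_def using \<delta> by (intro convex_half_sector) simp
          show "((deriv ^^ i) f has_field_derivative (deriv ^^ Suc i) f z) (at z within S)" if "z \<in> S" for i z
            using holomorphic_derivI[OF hol open_upper_half_plane, of z i] that
            by (auto simp: S_def half_sector_def upper_half_plane_def intro: DERIV_subset)
        qed (use B Suc ix tx in auto)
        also have "\<dots> \<le> B * cmod \<tau> ^ Suc n"
          using divide_left_mono[of 1 "fact n" "B * cmod \<tau> ^ Suc n"] B0 by (simp add: fact_ge_1)
        finally show ?thesis using Suc by (simp add: lessThan_Suc_atMost)
      qed
      then have "cmod (d x) \<le> B * cmod \<tau> ^ N * exp (x / 2)"
        unfolding deq norm_mult by (intro mult_mono) (use B0 in auto)
      then show ?thesis by (simp add: B_def mult_ac)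
    qed
    note di = integrable_exp_dominated[OF dcont _ dle, simplified]
    have "f (\<tau> + \<i> * of_real (exp x)) * exp ((1/2) * complex_of_real x)
        = d x + (\<Sum>l<N. g l x / fact l * \<tau> ^ l)" for x by (simp add: d_def)
    then have "vmellin f \<tau> (1/2) = (LINT x|lborel. d x + (\<Sum>l<N. g l x / fact l * \<tau> ^ l))"
      unfolding vmellin_def by simp
    also have "\<dots> = (LINT x|lborel. d x) + (\<Sum>l<N. (LINT x|lborel. g l x) / fact l * \<tau> ^ l)"
      using di(1) gint
      by (subst Bochner_Integration.integral_add) (auto simp: Bochner_Integration.integral_sum)
    also have "(\<lambda>l. LINT x|lborel. g l x) = (\<lambda>l. vmellin ((deriv ^^ l) f) 0 (1/2))"
      by (simp add: g_def vmellin_def)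
    finally have "vmellin f \<tau> (1/2) - (\<Sum>l<N. vmellin ((deriv ^^ l) f) 0 (1/2) / fact l * \<tau> ^ l) = (LINT x|lborel. d x)"
      by (simp add: fun_eq_iff)
    then show "cmod (vmellin f \<tau> (1/2) - (\<Sum>l<N. vmellin ((deriv ^^ l) f) 0 (1/2) / fact l * \<tau> ^ l))
        \<le> (C * ?I) * cmod \<tau> ^ N"
      using integrable_exp_dominated(2)[OF dcont _ dle] by (simp add: mult_ac)
  qed
qed

section \<open>Gamma integrals and termwise integration\<close>

text \<open>
  This is \<open>y \<le> exp y\<close> at \<open>y = u / \<sigma>\<close>, raised to the power \<open>\<sigma>\<close>.
\<close>
lemma exp_minus_le_powr:
  fixes u \<sigma> :: real
  assumes "u > 0" "\<sigma> > 0"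
  shows "exp (- u) \<le> \<sigma> powr \<sigma> * u powr (- \<sigma>)"
proof -
  have "u / \<sigma> \<le> exp (u / \<sigma>)" using exp_ge_add_one_self[of "u / \<sigma>"] by linarith
  then have "(u / \<sigma>) powr \<sigma> \<le> exp (u / \<sigma>) powr \<sigma>" using assms by (intro powr_mono2) auto
  also have "\<dots> = exp u" using assms by (simp add: exp_powr_real)
  finally have "u powr \<sigma> / \<sigma> powr \<sigma> \<le> exp u" using assms by (simp add: powr_divide)
  then show ?thesis using assms by (simp add: exp_minus powr_minus divide_simps mult_ac)
qed

lemma exp_integrand_integrable:
  assumes s: "Re s > 0"
  shows "integrable lborel (\<lambda>x. exp (- of_real (exp x)) * exp (s * complex_of_real x))"
proof -
  define C where "C = 1 + (2 * Re s) powr (2 * Re s)"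
  have "cmod (exp (- of_real (exp x)) * exp (s * complex_of_real x)) \<le> C * exp (- Re s * \<bar>x\<bar>)" for x
  proof (cases "x \<ge> 0")
    case True
    have "exp (- exp x) \<le> (2 * Re s) powr (2 * Re s) * exp x powr (- (2 * Re s))"
      using s by (intro exp_minus_le_powr) auto
    then have "exp (- exp x) * exp (Re s * x) \<le> (2 * Re s) powr (2 * Re s) * exp x powr (- (2 * Re s)) * exp (Re s * x)"
      by (intro mult_right_mono) auto
    also have "\<dots> = (2 * Re s) powr (2 * Re s) * exp (- Re s * \<bar>x\<bar>)"
      using True by (simp add: powr_def mult.assoc flip: exp_add)
    also have "\<dots> \<le> C * exp (- Re s * \<bar>x\<bar>)" unfolding C_def by (intro mult_right_mono) auto
    finally show ?thesis by (simp add: norm_mult)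
  next
    case False
    have "exp (- exp x) * exp (Re s * x) \<le> 1 * exp (Re s * x)" by (intro mult_right_mono) auto
    also have "\<dots> \<le> C * exp (- Re s * \<bar>x\<bar>)" using False unfolding C_def by (intro mult_mono) auto
    finally show ?thesis by (simp add: norm_mult)
  qed
  then show ?thesis
    using s by (intro integrable_exp_dominated(1)[of _ "Re s" C]) (auto intro!: continuous_intros)
qed

lemma Gamma_integral_exp:
  assumes s: "Re s > 0"
  shows "(LINT x|lborel. exp (- of_real (exp x)) * exp (s * complex_of_real x)) = Gamma s"
proof -
  define f where "f = (\<lambda>t. complex_of_real t powr (s - 1) / of_real (exp t))"
  have f_exp: "exp x *\<^sub>R f (exp x) = exp (- of_real (exp x)) * exp (s * complex_of_real x)" for x
    by (simp add: f_def powr_def exp_minus exp_of_real scaleR_conv_of_real field_simps flip: exp_add Ln_of_real exp_of_real)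
  have meas: "set_borel_measurable lborel {0<..} f"
    unfolding f_def set_borel_measurable_def
    by (auto intro!: borel_measurable_continuous_on_indicator continuous_intros)
  have int: "set_integrable lborel {0<..} f"
    using absolutely_integrable_Gamma_integral'[OF s] meas
    unfolding f_def set_integrable_def set_borel_measurable_def by (simp add: integrable_completion)
  have "(LBINT t=0..\<infinity>. f t) = (LBINT x=-\<infinity>..\<infinity>. exp x *\<^sub>R f (exp x))"
  proof (rule interval_integral_substitution_integrable)
    show "isCont f (exp x)" for x
      unfolding f_def by (intro continuous_intros) auto
    show "((ereal \<circ> exp \<circ> real_of_ereal) \<longlongrightarrow> 0) (at_right (- \<infinity>))"
      unfolding comp_assoc[symmetric] zero_ereal_def
      by (auto simp: ereal_tendsto_simps comp_assoc intro: exp_at_bot)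
    show "((ereal \<circ> exp \<circ> real_of_ereal) \<longlongrightarrow> \<infinity>) (at_left \<infinity>)"
      by (simp add: comp_def ereal_tendsto_simps at_left_PInf filterlim_filtermap
          tendsto_PInfty_eq_at_top exp_at_top)
    show "set_integrable lborel (einterval (- \<infinity>) \<infinity>) (\<lambda>x. exp x *\<^sub>R f (exp x))"
      using exp_integrand_integrable[OF s] by (simp add: f_exp set_integrable_def)
    show "set_integrable lborel (einterval 0 \<infinity>) f" using int by (simp add: zero_ereal_def)
  qed (auto intro: DERIV_exp)
  also have "\<dots> = (LINT x|lborel. exp (- of_real (exp x)) * exp (s * complex_of_real x))"
    by (simp add: f_exp interval_lebesgue_integral_def set_lebesgue_integral_def)
  also have "(LBINT t=0..\<infinity>. f t) = integral {0<..} f"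
    using int by (simp add: interval_lebesgue_integral_def zero_ereal_def set_borel_integral_eq_integral)
  also have "\<dots> = Gamma s"
    using Gamma_integral_complex'[OF s] unfolding f_def by (rule integral_unique)
  finally show ?thesis by simp
qed

lemma Gamma_integral_exp_scaled:
  assumes s: "Re s > 0" and c: "c > 0"
  shows "has_bochner_integral lborel (\<lambda>x. exp (- of_real (c * exp x)) * exp (s * complex_of_real x))
           (Gamma s * of_real c powr (- s))"
proof -
  have "has_bochner_integral lborel (\<lambda>x. exp (- of_real (exp x)) * exp (s * complex_of_real x)) (Gamma s)"
    using exp_integrand_integrable[OF s] Gamma_integral_exp[OF s] by (simp add: has_bochner_integral_iff)
  then have "has_bochner_integral lborel
      (\<lambda>x. exp (- of_real (exp (ln c + 1 * x))) * exp (s * complex_of_real (ln c + 1 * x))) (Gamma s /\<^sub>R \<bar>1\<bar>)"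
    by (subst lborel_has_bochner_integral_real_affine_iff[symmetric]) auto
  then have "has_bochner_integral lborel
      (\<lambda>x. (exp (- of_real (exp (ln c + 1 * x))) * exp (s * complex_of_real (ln c + 1 * x))) * of_real c powr (- s))
      (Gamma s /\<^sub>R \<bar>1\<bar> * of_real c powr (- s))"
    by (intro has_bochner_integral_mult_left) auto
  moreover have "(exp (- of_real (exp (ln c + 1 * x))) * exp (s * complex_of_real (ln c + 1 * x))) * of_real c powr (- s)
      = exp (- of_real (c * exp x)) * exp (s * complex_of_real x)" for x
  proof -
    have "exp (s * complex_of_real (ln c + 1 * x)) * of_real c powr (- s) = exp (s * complex_of_real x)"
      using c by (simp add: powr_def Ln_of_real distrib_left flip: exp_add)
    then show ?thesis using c by (simp add: exp_add mult.assoc)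
  qed
  ultimately show ?thesis by simp
qed

text \<open>
  Each term contributes a Gamma integral, and the summability hypothesis says that the integrals of the
  absolute values have a finite sum. The two cases of interest are \<open>\<tau> = 0\<close>, where the result is a
  completed Dirichlet series, and \<open>s = 1/2\<close> with \<open>\<tau>\<close> in the upper half-plane, where it is an Eichler
  integral.
\<close>
lemma vmellin_termwise:
  fixes \<mu> :: "nat \<Rightarrow> real"
  assumes s: "Re s > 0" and \<mu>: "\<And>n. \<mu> n > 0" and \<tau>: "Im \<tau> \<ge> 0"
    and f: "\<And>z. Im z > 0 \<Longrightarrow> (\<lambda>n. b n * q_pow (\<mu> n) z) sums f z"
    and sm: "summable (\<lambda>n. cmod (b n * q_pow (\<mu> n) \<tau>) * \<mu> n powr (- Re s))"
  shows "vmellin f \<tau> s = Gamma s * (2 * of_real pi) powr (- s) *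
           (\<Sum>n. b n * q_pow (\<mu> n) \<tau> * of_real (\<mu> n) powr (- s))"
proof -
  define c where "c = (\<lambda>n. b n * q_pow (\<mu> n) \<tau>)"
  define e where "e = (\<lambda>n s x. exp (- of_real (2 * pi * \<mu> n * exp x)) * exp (s * complex_of_real x))"
  have hb: "has_bochner_integral lborel (e n s') (Gamma s' * of_real (2 * pi * \<mu> n) powr (- s'))"
    if "Re s' > 0" for n s'
    unfolding e_def using Gamma_integral_exp_scaled[OF that, of "2 * pi * \<mu> n"] \<mu>[of n] by (simp add: mult_ac)
  have term_eq: "b n * q_pow (\<mu> n) (\<tau> + \<i> * of_real (exp x)) * exp (s * of_real x) = c n * e n s x" for n x
    by (simp add: c_def e_def q_pow_def algebra_simps flip: exp_add)
  have norm_e: "cmod (e n s x) = Re (e n (Re s) x)" for n x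
    by (simp add: e_def norm_mult exp_of_real flip: of_real_minus of_real_mult)
  have int: "integrable lborel (\<lambda>x. c n * e n s x)" for n
    using hb[OF s, of n] by (auto simp: has_bochner_integral_iff)
  have nint: "(LINT x|lborel. cmod (c n * e n s x)) =
      (Gamma (Re s) * (2 * pi) powr (- Re s)) * (cmod (c n) * \<mu> n powr (- Re s))" for n
  proof -
    have "complex_of_real (2 * pi * \<mu> n) powr (- of_real (Re s)) = of_real ((2 * pi * \<mu> n) powr (- Re s))"
      using powr_of_real[of "2 * pi * \<mu> n" "- Re s"] \<mu>[of n] by simp
    then have "Gamma (complex_of_real (Re s)) * of_real (2 * pi * \<mu> n) powr (- of_real (Re s))
        = of_real (Gamma (Re s) * (2 * pi * \<mu> n) powr (- Re s))"
      unfolding Gamma_complex_of_real by (simp only: of_real_mult)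
    then have "has_bochner_integral lborel (e n (Re s)) (of_real (Gamma (Re s) * (2 * pi * \<mu> n) powr (- Re s)))"
      using hb[of "Re s" n] s by simp
    then have "has_bochner_integral lborel (\<lambda>x. Re (e n (Re s) x)) (Re (of_real (Gamma (Re s) * (2 * pi * \<mu> n) powr (- Re s))))"
      by (rule has_bochner_integral_bounded_linear[OF bounded_linear_Re])
    then show ?thesis
      using \<mu>[of n] by (simp add: norm_mult norm_e has_bochner_integral_iff powr_mult mult_ac)
  qed
  have smx: "summable (\<lambda>n. cmod (c n * e n s x))" for x
  proof (rule summable_comparison_test[OF _ summable_mult[OF sm]], intro exI allI impI)
    fix n :: nat
    define K where "K = Re s powr Re s * (2 * pi * exp x) powr (- Re s) * exp (Re s * x)"
    have "exp (- (2 * pi * \<mu> n * exp x)) \<le> Re s powr Re s * (2 * pi * \<mu> n * exp x) powr (- Re s)"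
      using s \<mu>[of n] by (intro exp_minus_le_powr) auto
    then have "exp (- (2 * pi * \<mu> n * exp x)) * exp (Re s * x)
        \<le> Re s powr Re s * (2 * pi * \<mu> n * exp x) powr (- Re s) * exp (Re s * x)"
      by (intro mult_right_mono) auto
    also have "\<dots> = K * \<mu> n powr (- Re s)"
      using \<mu>[of n] by (simp add: K_def powr_mult mult_ac)
    finally have "cmod (e n s x) \<le> K * \<mu> n powr (- Re s)"
      by (simp add: e_def norm_mult)
    then have "cmod (c n) * cmod (e n s x) \<le> cmod (c n) * (K * \<mu> n powr (- Re s))"
      by (intro mult_left_mono) auto
    then show "norm (cmod (c n * e n s x)) \<le> K * (cmod (b n * q_pow (\<mu> n) \<tau>) * \<mu> n powr (- Re s))"
      by (simp add: c_def norm_mult mult_ac)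
  qed
  have "vmellin f \<tau> s = (LINT x|lborel. (\<Sum>n. c n * e n s x))"
    unfolding vmellin_def
  proof (rule Bochner_Integration.integral_cong[OF refl])
    fix x :: real
    have "(\<lambda>n. b n * q_pow (\<mu> n) (\<tau> + \<i> * of_real (exp x)) * exp (s * of_real x))
        sums (f (\<tau> + \<i> * of_real (exp x)) * exp (s * of_real x))"
      using \<tau> by (intro sums_mult2 f) (simp add: add_nonneg_pos)
    then show "f (\<tau> + \<i> * of_real (exp x)) * exp (s * of_real x) = (\<Sum>n. c n * e n s x)"
      unfolding term_eq by (simp add: sums_iff)
  qed
  also have "\<dots> = (\<Sum>n. (LINT x|lborel. c n * e n s x))"
  proof (intro integral_suminf int AE_I2 smx)
    show "summable (\<lambda>n. LINT x|lborel. cmod (c n * e n s x))"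
      unfolding nint using sm by (intro summable_mult) (simp add: c_def)
  qed
  also have "\<dots> = (\<Sum>n. (Gamma s * (2 * of_real pi) powr (- s)) * (c n * of_real (\<mu> n) powr (- s)))"
  proof (rule suminf_cong)
    fix n
    have "complex_of_real (2 * pi * \<mu> n) powr (- s) = (2 * of_real pi) powr (- s) * of_real (\<mu> n) powr (- s)"
      using powr_times_real[of "2 * of_real pi" "of_real (\<mu> n)" "- s"] \<mu>[of n] by (simp add: less_imp_le)
    then show "(LINT x|lborel. c n * e n s x) = (Gamma s * (2 * of_real pi) powr (- s)) * (c n * of_real (\<mu> n) powr (- s))"
      using hb[OF s, of n] by (simp add: has_bochner_integral_iff mult_ac)
  qed
  also have "\<dots> = (Gamma s * (2 * of_real pi) powr (- s)) * (\<Sum>n. c n * of_real (\<mu> n) powr (- s))"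
  proof (rule suminf_mult)
    have "norm (c n * of_real (\<mu> n) powr (- s)) = cmod (c n) * \<mu> n powr (- Re s)" for n
      using \<mu>[of n] by (simp add: norm_mult norm_powr_real_powr)
    then show "summable (\<lambda>n. c n * of_real (\<mu> n) powr (- s))"
      using sm by - (rule summable_norm_cancel, simp add: c_def)
  qed
  finally show ?thesis by (simp add: c_def)
qed

section \<open>Fourier series with an inversion formula\<close>

text \<open>
  The positive multiples of \<open>1 / D\<close> contain the exponents of all components of a cusp form, so that one
  index set serves all of them. The shift by one excludes the exponent 0.
\<close>
definition freq :: "nat \<Rightarrow> nat \<Rightarrow> real" where
  "freq D m = real (Suc m) / real D"

lemma norm_q_pow: "cmod (q_pow \<mu> z) = exp (- (2 * pi * \<mu> * Im z))"
  by (simp add: q_pow_def algebra_simps)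

lemma q_pow_has_field_derivative:
  "(q_pow \<mu> has_field_derivative (2 * of_real pi * \<i> * of_real \<mu>) * q_pow \<mu> z) (at z)"
  unfolding q_pow_def by (auto intro!: derivative_eq_intros)

lemma norm_powr_of_real: "w \<noteq> 0 \<Longrightarrow> cmod (w powr of_real p) = cmod w powr p"
  by (simp add: powr_def)

lemma powr_imaginary_exp:
  "(\<i> * of_real (exp x)) powr of_real p = \<i> powr of_real p * exp (of_real p * of_real x)"
proof -
  have "Ln (\<i> * of_real (exp x)) = Ln \<i> + of_real x"
    using Ln_times_of_real[of "exp x" \<i>] by (simp add: Ln_of_real mult.commute)
  then show ?thesis by (simp add: powr_def distrib_left exp_add)
qed

text \<open>
  What the analysis needs to know about a cusp form: \<open>R\<close> stands for \<open>\<rho> S\<close>, the sequence \<open>b j\<close> lists the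
  Fourier coefficients of \<open>G j\<close> along the lattice, and \<open>n0\<close> selects the weight, 3/2 or 1/2.
\<close>
locale fourier_vector =
  fixes D r n0 :: nat and \<kappa> :: real
    and R :: "nat \<Rightarrow> nat \<Rightarrow> complex" and b :: "nat \<Rightarrow> nat \<Rightarrow> complex" and G :: "nat \<Rightarrow> complex \<Rightarrow> complex"
  assumes D: "D > 0" and n0: "n0 \<le> 1" and \<kappa>: "\<kappa> = 3/2 - real n0"
    and dirichlet_summable: "\<And>j \<sigma>. j < r \<Longrightarrow> \<sigma> > 1 + \<kappa> / 2 \<Longrightarrow>
          summable (\<lambda>m. cmod (b j m) * freq D m powr (- \<sigma>))"
    and holomorphic: "\<And>j. j < r \<Longrightarrow> G j holomorphic_on upper_half_plane"
    and fourier: "\<And>j z. j < r \<Longrightarrow> Im z > 0 \<Longrightarrow> (\<lambda>m. b j m * q_pow (freq D m) z) sums G j z"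
    and modular: "\<And>j z. j < r \<Longrightarrow> Im z > 0 \<Longrightarrow>
          G j (- 1 / z) = z powr of_real \<kappa> * (\<Sum>i<r. R j i * G i z)"
begin

abbreviation \<mu> :: "nat \<Rightarrow> real" where "\<mu> \<equiv> freq D"

lemma weight_bounds: "1/2 \<le> \<kappa>" "\<kappa> \<le> 3/2"
  using \<kappa> n0 by (cases n0; simp)+

lemma freq_pos: "\<mu> m > 0" using D by (simp add: freq_def)

lemma norm_q_pow_le:
  assumes "y > 0" "\<sigma> > 0"
  shows "exp (- (2 * pi * \<mu> m * y)) \<le> (\<sigma> powr \<sigma> * (2 * pi * y) powr (- \<sigma>)) * \<mu> m powr (- \<sigma>)"
proof -
  have "exp (- (2 * pi * \<mu> m * y)) \<le> \<sigma> powr \<sigma> * (2 * pi * \<mu> m * y) powr (- \<sigma>)"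
    using assms freq_pos[of m] by (intro exp_minus_le_powr) auto
  then show ?thesis using assms freq_pos[of m] by (simp add: powr_mult mult_ac)
qed

lemma fourier_summable:
  assumes "j < r" "y > 0"
  shows "summable (\<lambda>m. cmod (b j m) * \<mu> m powr p * exp (- (2 * pi * \<mu> m * y)))"
proof -
  define \<sigma> where "\<sigma> = 2 + \<bar>p\<bar>"
  have "summable (\<lambda>m. cmod (b j m) * \<mu> m powr (- 2 + (p - \<bar>p\<bar>)) * (\<sigma> powr \<sigma> * (2 * pi * y) powr (- \<sigma>)))"
    using dirichlet_summable[OF assms(1), of "2 - (p - \<bar>p\<bar>)"] weight_bounds
    by (intro summable_mult2) (auto simp: algebra_simps)
  then show ?thesis
  proof (rule summable_comparison_test[rotated], intro exI allI impI)
    fix m :: nat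
    have "exp (- (2 * pi * \<mu> m * y)) \<le> (\<sigma> powr \<sigma> * (2 * pi * y) powr (- \<sigma>)) * \<mu> m powr (- \<sigma>)"
      using assms by (intro norm_q_pow_le) (auto simp: \<sigma>_def)
    then have "cmod (b j m) * \<mu> m powr p * exp (- (2 * pi * \<mu> m * y))
        \<le> cmod (b j m) * \<mu> m powr p * ((\<sigma> powr \<sigma> * (2 * pi * y) powr (- \<sigma>)) * \<mu> m powr (- \<sigma>))"
      by (intro mult_left_mono) auto
    also have "\<dots> = cmod (b j m) * (\<mu> m powr p * \<mu> m powr (- \<sigma>)) * (\<sigma> powr \<sigma> * (2 * pi * y) powr (- \<sigma>))"
      by (simp add: mult_ac)
    also have "\<mu> m powr p * \<mu> m powr (- \<sigma>) = \<mu> m powr (- 2 + (p - \<bar>p\<bar>))"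
      by (simp add: \<sigma>_def algebra_simps flip: powr_add)
    finally show "norm (cmod (b j m) * \<mu> m powr p * exp (- (2 * pi * \<mu> m * y)))
        \<le> cmod (b j m) * \<mu> m powr (- 2 + (p - \<bar>p\<bar>)) * (\<sigma> powr \<sigma> * (2 * pi * y) powr (- \<sigma>))"
      by simp
  qed
qed

text \<open>
  Replacing the exponential by a power of its argument turns the Fourier series into an absolutely
  convergent Dirichlet series.
\<close>
lemma fourier_bound:
  assumes j: "j < r" and \<sigma>: "\<sigma> \<ge> 2"
  obtains C where "C \<ge> 0" "\<And>z. Im z > 0 \<Longrightarrow> cmod (G j z) \<le> C * Im z powr (- \<sigma>)"
proof -
  have sm: "summable (\<lambda>m. cmod (b j m) * \<mu> m powr (- \<sigma>))"
    using dirichlet_summable[OF j, of \<sigma>] weight_bounds \<sigma> by simp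
  define C where "C = \<sigma> powr \<sigma> * (2 * pi) powr (- \<sigma>) * (\<Sum>m. cmod (b j m) * \<mu> m powr (- \<sigma>))"
  have "C \<ge> 0" unfolding C_def by (intro mult_nonneg_nonneg suminf_nonneg sm) auto
  moreover have "cmod (G j z) \<le> C * Im z powr (- \<sigma>)" if z: "Im z > 0" for z
  proof -
    define K where "K = \<sigma> powr \<sigma> * (2 * pi * Im z) powr (- \<sigma>)"
    have le: "cmod (b j m * q_pow (\<mu> m) z) \<le> K * (cmod (b j m) * \<mu> m powr (- \<sigma>))" for m
    proof -
      have "cmod (b j m) * exp (- (2 * pi * \<mu> m * Im z)) \<le> cmod (b j m) * (K * \<mu> m powr (- \<sigma>))"
        unfolding K_def using z \<sigma> by (intro mult_left_mono norm_q_pow_le) auto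
      then show ?thesis by (simp add: norm_mult norm_q_pow mult_ac)
    qed
    have "cmod (\<Sum>m. b j m * q_pow (\<mu> m) z) \<le> (\<Sum>m. K * (cmod (b j m) * \<mu> m powr (- \<sigma>)))"
      by (intro norm_suminf_le le summable_mult sm)
    also have "\<dots> = K * (\<Sum>m. cmod (b j m) * \<mu> m powr (- \<sigma>))" by (intro suminf_mult sm)
    also have "\<dots> = C * Im z powr (- \<sigma>)" using z by (simp add: C_def K_def powr_mult)
    finally show ?thesis using fourier[OF j z] by (simp add: sums_iff)
  qed
  ultimately show ?thesis using that by blast
qed

lemma fourier_higher_deriv:
  assumes j: "j < r" and z: "Im z > 0"
  shows "(\<lambda>m. (2 * of_real pi * \<i> * of_real (\<mu> m)) ^ n * b j m * q_pow (\<mu> m) z) sums (deriv ^^ n) (G j) z"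
  using z
proof (induction n arbitrary: z)
  case 0
  then show ?case using fourier[OF j] by simp
next
  case (Suc n)
  define a where "a = (\<lambda>m. 2 * of_real pi * \<i> * of_real (\<mu> m) :: complex)"
  define c where "c = (\<lambda>m. a m ^ n * b j m)"
  have IH: "(\<lambda>m. c m * q_pow (\<mu> m) w) sums (deriv ^^ n) (G j) w" if "Im w > 0" for w
    using Suc.IH[OF that] by (simp add: c_def a_def)
  have "\<exists>g'. \<forall>x\<in>upper_half_plane. ((deriv ^^ n) (G j) has_field_derivative g' x) (at x) \<and>
      (\<lambda>N. \<Sum>m<N. c m * (a m * q_pow (\<mu> m) x)) \<longlonglongrightarrow> g' x"
  proof (rule has_complex_derivative_uniform_sequence[OF open_upper_half_plane,
        where f = "\<lambda>N x. \<Sum>m<N. c m * q_pow (\<mu> m) x"])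
    show "((\<lambda>x. \<Sum>m<N. c m * q_pow (\<mu> m) x) has_field_derivative
        (\<Sum>m<N. c m * (a m * q_pow (\<mu> m) x))) (at x)" for N x
      unfolding a_def by (intro DERIV_sum DERIV_cmult q_pow_has_field_derivative)
    fix x assume "x \<in> upper_half_plane"
    then have x: "Im x > 0" by (simp add: upper_half_plane_def)
    have im: "Im w \<ge> Im x / 2" if "w \<in> cball x (Im x / 2)" for w
      using that abs_Im_le_cmod[of "x - w"] by (simp add: dist_norm)
    have "uniform_limit (cball x (Im x / 2)) (\<lambda>N w. \<Sum>m<N. c m * q_pow (\<mu> m) w)
        (\<lambda>w. \<Sum>m. c m * q_pow (\<mu> m) w) sequentially"
    proof (rule Weierstrass_m_test)
      show "summable (\<lambda>m. (2 * pi) ^ n * (cmod (b j m) * \<mu> m powr real n * exp (- (2 * pi * \<mu> m * (Im x / 2)))))"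
        using x by (intro summable_mult fourier_summable j) simp
      fix m w assume w: "w \<in> cball x (Im x / 2)"
      have "exp (- (2 * pi * \<mu> m * Im w)) \<le> exp (- (2 * pi * \<mu> m * (Im x / 2)))"
        using im[OF w] freq_pos[of m] by (simp add: mult_left_mono)
      moreover have "cmod (c m) = (2 * pi) ^ n * (cmod (b j m) * \<mu> m powr real n)"
        using freq_pos[of m] by (simp add: c_def a_def norm_mult norm_power power_mult_distrib powr_realpow mult_ac)
      ultimately show "cmod (c m * q_pow (\<mu> m) w)
          \<le> (2 * pi) ^ n * (cmod (b j m) * \<mu> m powr real n * exp (- (2 * pi * \<mu> m * (Im x / 2))))"
        by (simp add: norm_mult norm_q_pow mult_left_mono mult.assoc)
    qed
    moreover have "(\<Sum>m. c m * q_pow (\<mu> m) w) = (deriv ^^ n) (G j) w" if "w \<in> cball x (Im x / 2)" for w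
      using IH[of w] im[OF that] x by (simp add: sums_iff)
    ultimately have "uniform_limit (cball x (Im x / 2)) (\<lambda>N w. \<Sum>m<N. c m * q_pow (\<mu> m) w)
        ((deriv ^^ n) (G j)) sequentially"
      by (subst (asm) uniform_limit_cong'[OF refl]) auto
    then show "\<exists>d>0. cball x d \<subseteq> upper_half_plane \<and>
        uniform_limit (cball x d) (\<lambda>N w. \<Sum>m<N. c m * q_pow (\<mu> m) w) ((deriv ^^ n) (G j)) sequentially"
      using x im by (intro exI[of _ "Im x / 2"]) (fastforce simp: upper_half_plane_def)
  qed
  then obtain g' where g': "((deriv ^^ n) (G j) has_field_derivative g') (at z)"
      "(\<lambda>N. \<Sum>m<N. c m * (a m * q_pow (\<mu> m) z)) \<longlonglongrightarrow> g'"
    using Suc.prems by (auto simp: upper_half_plane_def)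
  from g'(1) have "g' = (deriv ^^ Suc n) (G j) z" by (simp add: DERIV_imp_deriv)
  with g'(2) show ?case by (simp add: sums_def c_def a_def mult_ac)
qed

text \<open>
  For \<open>\<bar>z\<bar> \<ge> 1\<close> the power bound in \<open>Im z\<close> suffices. For \<open>\<bar>z\<bar> < 1\<close> the inversion formula transports that
  bound from \<open>- 1 / z\<close>, whose imaginary part is at least \<open>\<delta> / \<bar>z\<bar>\<close> in the sector.
\<close>
lemma fourier_rapid:
  assumes j: "j < r"
  shows "rapid (G j)"
  unfolding rapid_def
proof (intro conjI allI impI)
  show "G j holomorphic_on upper_half_plane" by (rule holomorphic[OF j])
  fix \<delta> p :: real assume \<delta>: "\<delta> > 0"
  \<comment> \<open>Large enough for the power bound, for the decay at infinity and, after the loss of \<open>\<kappa>\<close>, at 0.\<close>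
  define \<sigma> where "\<sigma> = \<bar>p\<bar> + 4"
  have \<sigma>: "\<sigma> \<ge> 2" "- \<sigma> \<le> p" "p \<le> \<sigma> - \<kappa>" using weight_bounds by (auto simp: \<sigma>_def)
  have "\<exists>C. \<forall>i<r. C i \<ge> 0 \<and> (\<forall>z. Im z > 0 \<longrightarrow> cmod (G i z) \<le> C i * Im z powr (- \<sigma>))"
  proof -
    have "\<exists>C. i < r \<longrightarrow> C \<ge> 0 \<and> (\<forall>z. Im z > 0 \<longrightarrow> cmod (G i z) \<le> C * Im z powr (- \<sigma>))" for i
      using fourier_bound[OF _ \<sigma>(1), of i] by blast
    then show ?thesis by (intro choice allI)
  qed
  then obtain C where C0: "\<And>i. i < r \<Longrightarrow> C i \<ge> 0"
    and C: "\<And>i z. i < r \<Longrightarrow> Im z > 0 \<Longrightarrow> cmod (G i z) \<le> C i * Im z powr (- \<sigma>)" by blast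
  define K where "K = (\<Sum>i<r. cmod (R j i) * C i)"
  have K0: "K \<ge> 0" unfolding K_def by (intro sum_nonneg mult_nonneg_nonneg C0) auto
  show "\<exists>C. \<forall>z\<in>half_sector \<delta>. cmod (G j z) \<le> C * cmod z powr p"
  proof (intro exI ballI)
    fix z assume "z \<in> half_sector \<delta>"
    then have z: "Im z > 0" "\<delta> * cmod z \<le> Im z" by (auto simp: half_sector_def)
    then have z0: "cmod z > 0" "z \<noteq> 0" by auto
    show "cmod (G j z) \<le> ((C j + K) * \<delta> powr (- \<sigma>)) * cmod z powr p"
    proof (cases "cmod z \<ge> 1")
      case True
      have "cmod (G j z) \<le> C j * Im z powr (- \<sigma>)" by (rule C[OF j z(1)])
      also have "\<dots> \<le> C j * (\<delta> * cmod z) powr (- \<sigma>)"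
        using z z0 \<delta> \<sigma> by (intro mult_left_mono powr_mono2' C0 j) auto
      also have "\<dots> = C j * \<delta> powr (- \<sigma>) * cmod z powr (- \<sigma>)" using \<delta> z0 by (simp add: powr_mult)
      also have "\<dots> \<le> ((C j + K) * \<delta> powr (- \<sigma>)) * cmod z powr p"
        using True K0 C0[OF j] \<sigma> by (intro mult_mono[OF mult_right_mono powr_mono]) auto
      finally show ?thesis .
    next
      case False
      define w where "w = - 1 / z"
      have imw: "Im w = Im z / (cmod z)\<^sup>2" by (simp add: w_def Im_divide cmod_power2)
      have w: "Im w > 0" using z z0 by (simp add: imw)
      have dw: "\<delta> / cmod z \<le> Im w" using z z0 by (simp add: imw power2_eq_square field_simps)
      have "- 1 / w = z" using z0 by (simp add: w_def)
      then have "G j z = w powr of_real \<kappa> * (\<Sum>i<r. R j i * G i w)" using modular[OF j w] by simp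
      then have "cmod (G j z) = cmod z powr (- \<kappa>) * cmod (\<Sum>i<r. R j i * G i w)"
        using z0 by (simp add: norm_mult norm_powr_of_real w_def norm_divide powr_divide powr_minus_divide)
      also have "cmod (\<Sum>i<r. R j i * G i w) \<le> (\<Sum>i<r. cmod (R j i) * (C i * (\<delta> / cmod z) powr (- \<sigma>)))"
      proof (intro sum_norm_le)
        fix i assume "i \<in> {..<r}"
        then have i: "i < r" by simp
        have "cmod (G i w) \<le> C i * Im w powr (- \<sigma>)" by (rule C[OF i w])
        also have "\<dots> \<le> C i * (\<delta> / cmod z) powr (- \<sigma>)"
          using z0 \<delta> \<sigma> dw by (intro mult_left_mono powr_mono2' C0 i) auto
        finally show "cmod (R j i * G i w) \<le> cmod (R j i) * (C i * (\<delta> / cmod z) powr (- \<sigma>))"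
          by (simp add: norm_mult mult_left_mono)
      qed
      also have "(\<delta> / cmod z) powr (- \<sigma>) = \<delta> powr (- \<sigma>) * cmod z powr \<sigma>"
        using z0 \<delta> by (simp add: powr_divide powr_minus_divide)
      also have "(\<Sum>i<r. cmod (R j i) * (C i * (\<delta> powr (- \<sigma>) * cmod z powr \<sigma>))) = K * \<delta> powr (- \<sigma>) * cmod z powr \<sigma>"
        unfolding K_def sum_distrib_right by (simp add: mult_ac)
      finally have "cmod (G j z) \<le> (K * \<delta> powr (- \<sigma>)) * cmod z powr (\<sigma> - \<kappa>)"
        using z0 by (simp add: powr_diff powr_minus_divide mult_left_mono field_simps)
      also have "\<dots> \<le> ((C j + K) * \<delta> powr (- \<sigma>)) * cmod z powr p"
        using False K0 C0[OF j] \<sigma> z0 by (intro mult_mono[OF mult_right_mono powr_mono']) auto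
      finally show ?thesis .
    qed
  qed
qed

text \<open>
  The inversion of \<open>t\<close> is the reflection of \<open>x\<close>. On the positive imaginary axis the principal branch
  splits the automorphy factor as \<open>(\<i> t)^\<kappa> = \<i>^\<kappa> t^\<kappa>\<close>, which is where the constant \<open>\<i>^\<kappa>\<close> comes from.
\<close>
lemma mellin_functional_equation:
  assumes j: "j < r"
  shows "vmellin (G j) 0 s = \<i> powr of_real \<kappa> * (\<Sum>i<r. R j i * vmellin (G i) 0 (of_real \<kappa> - s))"
proof -
  have "vmellin (G j) 0 s = (LINT x|lborel. G j (\<i> * of_real (exp (0 + - 1 * x))) * exp (s * of_real (0 + - 1 * x)))"
    unfolding vmellin_def by (subst lborel_integral_real_affine[of "- 1" _ 0]) auto
  also have "\<dots> = (LINT x|lborel. \<i> powr of_real \<kappa> *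
      (\<Sum>i<r. R j i * (G i (\<i> * of_real (exp x)) * exp ((of_real \<kappa> - s) * of_real x))))"
  proof (rule Bochner_Integration.integral_cong[OF refl])
    fix x :: real
    have "\<i> * of_real (exp (0 + - 1 * x)) = - 1 / (\<i> * of_real (exp x))"
      by (simp add: exp_minus field_simps flip: exp_of_real)
    then have "G j (\<i> * of_real (exp (0 + - 1 * x))) =
        \<i> powr of_real \<kappa> * exp (of_real \<kappa> * of_real x) * (\<Sum>i<r. R j i * G i (\<i> * of_real (exp x)))"
      using modular[OF j, of "\<i> * of_real (exp x)"] by (simp add: powr_imaginary_exp)
    then have "G j (\<i> * of_real (exp (0 + - 1 * x))) * exp (s * of_real (0 + - 1 * x)) =
        \<i> powr of_real \<kappa> * ((exp (of_real \<kappa> * of_real x) * exp (s * of_real (0 + - 1 * x))) *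
          (\<Sum>i<r. R j i * G i (\<i> * of_real (exp x))))"
      by (simp only: mult_ac)
    also have "exp (of_real \<kappa> * of_real x) * exp (s * of_real (0 + - 1 * x)) = exp ((of_real \<kappa> - s) * of_real x)"
      by (simp add: algebra_simps flip: exp_add)
    finally show "G j (\<i> * of_real (exp (0 + - 1 * x))) * exp (s * of_real (0 + - 1 * x)) =
        \<i> powr of_real \<kappa> * (\<Sum>i<r. R j i * (G i (\<i> * of_real (exp x)) * exp ((of_real \<kappa> - s) * of_real x)))"
      by (simp add: sum_distrib_left mult_ac)
  qed
  also have "\<dots> = \<i> powr of_real \<kappa> * (\<Sum>i<r. R j i * vmellin (G i) 0 (of_real \<kappa> - s))"
  proof -
    have "integrable lborel (\<lambda>x. R j i * (G i (\<i> * of_real (exp x)) * exp ((of_real \<kappa> - s) * of_real x)))" if "i < r" for i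
      by (intro integrable_mult_right vmellin_0_integrable fourier_rapid that)
    then show ?thesis unfolding vmellin_def by (simp add: Bochner_Integration.integral_sum)
  qed
  finally show ?thesis .
qed

definition dirichlet :: "nat \<Rightarrow> complex \<Rightarrow> complex" where
  "dirichlet j s = (\<Sum>m. b j m * of_real (\<mu> m) powr (- s))"

lemma mellin_eq_dirichlet:
  assumes j: "j < r" and s: "Re s > 1 + \<kappa> / 2"
  shows "vmellin (G j) 0 s = (2 * of_real pi) powr (- s) * Gamma s * dirichlet j s"
proof -
  have "Re s > 0" using s weight_bounds by simp
  moreover have "summable (\<lambda>m. cmod (b j m * q_pow (\<mu> m) 0) * \<mu> m powr (- Re s))"
    using dirichlet_summable[OF j s] by (simp add: q_pow_def)
  ultimately have "vmellin (G j) 0 s = Gamma s * (2 * of_real pi) powr (- s) *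
       (\<Sum>m. b j m * q_pow (\<mu> m) 0 * of_real (\<mu> m) powr (- s))"
    by (intro vmellin_termwise freq_pos fourier j) auto
  then show ?thesis by (simp add: q_pow_def dirichlet_def mult_ac)
qed

end

section \<open>The Eichler integral\<close>

text \<open>
  The factor common to the quotients of all asymptotic coefficients of positive index by their Gamma
  values, for weight \<open>3/2 - n\<close>.
\<close>
definition borel_const :: "nat \<Rightarrow> complex" where
  "borel_const n = of_real (sqrt 2 / sqrt pi * (- 1 / (2 * pi)) ^ n / (2 * pi)) * \<i> powr of_real (3/2 - real n)"

context fourier_vector
begin

definition eichler :: "nat \<Rightarrow> complex \<Rightarrow> complex" where
  "eichler j \<tau> = (\<Sum>m. of_real (\<mu> m powr (1 - \<kappa>)) * b j m * q_pow (\<mu> m) \<tau>)"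

text \<open>
  Since \<open>1 - \<kappa> = n0 - 1/2\<close>, the factor \<open>\<mu>^(1 - \<kappa>)\<close> splits into \<open>\<mu>^n0\<close>, which is produced by
  differentiating \<open>n0\<close> times, and \<open>\<mu>^(- 1/2)\<close>, which is a Gamma integral.
\<close>
lemma eichler_eq_vmellin:
  assumes j: "j < r" and \<tau>: "Im \<tau> > 0"
  shows "eichler j \<tau> = of_real (sqrt 2) / (2 * of_real pi * \<i>) ^ n0 * vmellin ((deriv ^^ n0) (G j)) \<tau> (1/2)"
proof -
  let ?c = "(2 * of_real pi * \<i>) ^ n0 :: complex"
  have sm: "summable (\<lambda>m. cmod ((2 * of_real pi * \<i> * of_real (\<mu> m)) ^ n0 * b j m * q_pow (\<mu> m) \<tau>) * \<mu> m powr - Re (1/2))"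
  proof -
    have "cmod ((2 * of_real pi * \<i> * of_real (\<mu> m)) ^ n0 * b j m * q_pow (\<mu> m) \<tau>) * \<mu> m powr - Re (1/2)
       = (2 * pi) ^ n0 * (cmod (b j m) * \<mu> m powr (real n0 - 1/2) * exp (- (2 * pi * \<mu> m * Im \<tau>)))" for m
      using freq_pos[of m]
      by (simp add: norm_mult norm_power norm_q_pow power_mult_distrib powr_diff powr_realpow powr_minus_divide mult_ac)
    then show ?thesis using fourier_summable[OF j \<tau>] by (auto intro!: summable_mult)
  qed
  have "vmellin ((deriv ^^ n0) (G j)) \<tau> (1/2) = Gamma (1/2) * (2 * of_real pi) powr (- (1/2)) *
      (\<Sum>m. (2 * of_real pi * \<i> * of_real (\<mu> m)) ^ n0 * b j m * q_pow (\<mu> m) \<tau> * of_real (\<mu> m) powr (- (1/2)))"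
    using \<tau> sm by (intro vmellin_termwise freq_pos fourier_higher_deriv j) auto
  also have "(\<Sum>m. (2 * of_real pi * \<i> * of_real (\<mu> m)) ^ n0 * b j m * q_pow (\<mu> m) \<tau> * of_real (\<mu> m) powr (- (1/2)))
      = (\<Sum>m. ?c * (of_real (\<mu> m powr (1 - \<kappa>)) * b j m * q_pow (\<mu> m) \<tau>))"
  proof (rule suminf_cong)
    fix m
    have "complex_of_real (\<mu> m) ^ n0 * of_real (\<mu> m) powr (- (1/2)) = of_real (\<mu> m ^ n0 * \<mu> m powr (- (1/2)))"
      using powr_of_real[of "\<mu> m" "- (1/2)"] freq_pos[of m] by simp
    also have "\<mu> m ^ n0 * \<mu> m powr (- (1/2)) = \<mu> m powr (1 - \<kappa>)"
      using freq_pos[of m] by (simp add: \<kappa> flip: powr_realpow powr_add)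
    finally have "complex_of_real (\<mu> m) ^ n0 * of_real (\<mu> m) powr (- (1/2)) = of_real (\<mu> m powr (1 - \<kappa>))" .
    then show "(2 * of_real pi * \<i> * of_real (\<mu> m)) ^ n0 * b j m * q_pow (\<mu> m) \<tau> * of_real (\<mu> m) powr (- (1/2)) =
         ?c * (of_real (\<mu> m powr (1 - \<kappa>)) * b j m * q_pow (\<mu> m) \<tau>)"
      by (simp only: power_mult_distrib mult_ac)
  qed
  also have "\<dots> = ?c * eichler j \<tau>"
    unfolding eichler_def
  proof (rule suminf_mult)
    have "norm (of_real (\<mu> m powr (1 - \<kappa>)) * b j m * q_pow (\<mu> m) \<tau>)
        = cmod (b j m) * \<mu> m powr (1 - \<kappa>) * exp (- (2 * pi * \<mu> m * Im \<tau>))" for m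
      by (simp add: norm_mult norm_q_pow)
    then show "summable (\<lambda>m. of_real (\<mu> m powr (1 - \<kappa>)) * b j m * q_pow (\<mu> m) \<tau>)"
      using fourier_summable[OF j \<tau>, of "1 - \<kappa>"] by - (rule summable_norm_cancel, simp)
  qed
  also have "Gamma (1/2) * (2 * of_real pi) powr (- (1/2)) = complex_of_real (1 / sqrt 2)"
  proof -
    have "complex_of_real (2 * pi) powr of_real (- (1/2)) = of_real ((2 * pi) powr (- (1/2)))"
      by (rule powr_of_real) auto
    also have "(2 * pi) powr (- (1/2)) = 1 / sqrt (2 * pi)"
      by (simp add: powr_minus_divide powr_half_sqrt)
    finally show ?thesis by (simp add: Gamma_one_half_complex real_sqrt_mult)
  qed
  finally show ?thesis by (simp add: field_simps flip: of_real_mult)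
qed

definition asymptotic_coeff :: "nat \<Rightarrow> nat \<Rightarrow> complex" where
  "asymptotic_coeff j l =
     of_real (sqrt 2) / (2 * of_real pi * \<i>) ^ n0 * vmellin ((deriv ^^ (l + n0)) (G j)) 0 (1/2) / fact l"

lemma eichler_asymptotics:
  assumes j: "j < r" and \<delta>: "\<delta> > 0"
  obtains C where "\<And>\<tau>. \<tau> \<in> half_sector \<delta> \<Longrightarrow>
    cmod (eichler j \<tau> - (\<Sum>l<N. asymptotic_coeff j l * \<tau> ^ l)) \<le> C * cmod \<tau> ^ N"
proof -
  let ?c = "of_real (sqrt 2) / (2 * of_real pi * \<i>) ^ n0 :: complex"
  obtain C where C: "\<And>\<tau>. \<tau> \<in> half_sector \<delta> \<Longrightarrow> cmod (vmellin ((deriv ^^ n0) (G j)) \<tau> (1/2) -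
      (\<Sum>l<N. vmellin ((deriv ^^ l) ((deriv ^^ n0) (G j))) 0 (1/2) / fact l * \<tau> ^ l)) \<le> C * cmod \<tau> ^ N"
    using vmellin_taylor[OF rapid_higher_deriv[OF fourier_rapid[OF j]] \<delta>] by blast
  show ?thesis
  proof (rule that)
    fix \<tau> assume \<tau>: "\<tau> \<in> half_sector \<delta>"
    then have "Im \<tau> > 0" by (simp add: half_sector_def)
    then have "eichler j \<tau> - (\<Sum>l<N. asymptotic_coeff j l * \<tau> ^ l) =
      ?c * (vmellin ((deriv ^^ n0) (G j)) \<tau> (1/2) -
      (\<Sum>l<N. vmellin ((deriv ^^ l) ((deriv ^^ n0) (G j))) 0 (1/2) / fact l * \<tau> ^ l))"
      by (simp add: eichler_eq_vmellin[OF j] asymptotic_coeff_def right_diff_distrib sum_distrib_left funpow_add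
          mult_ac)
    then have "cmod (eichler j \<tau> - (\<Sum>l<N. asymptotic_coeff j l * \<tau> ^ l)) \<le> cmod ?c * (C * cmod \<tau> ^ N)"
      by (simp only: norm_mult mult_left_mono[OF C[OF \<tau>]] norm_ge_zero)
    then show "cmod (eichler j \<tau> - (\<Sum>l<N. asymptotic_coeff j l * \<tau> ^ l)) \<le> (cmod ?c * C) * cmod \<tau> ^ N"
      by (simp add: mult_ac)
  qed
qed

text \<open>
  Put \<open>n = l + n0\<close>. Integration by parts turns the derivative of order \<open>n\<close> into the Pochhammer symbol of
  \<open>1/2 - n\<close>, which is \<open>(- 1)^n\<close> times that of \<open>1/2\<close>, and moves the argument \<open>1/2\<close> of the Mellin
  transform to \<open>1/2 - n\<close>, which the functional equation maps to \<open>1 + l\<close>. As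
  \<open>Gamma (2 - \<kappa> + l) = Gamma (1/2 + n)\<close> is \<open>Gamma (1/2)\<close> times the same Pochhammer symbol, the quotient
  is free of it. The condition \<open>l \<ge> 1\<close> places \<open>1 + l\<close> in the half-plane of absolute convergence of the
  Dirichlet series.
\<close>
lemma asymptotic_coeff_eq:
  assumes j: "j < r" and l: "l \<ge> 1"
  shows "asymptotic_coeff j l / Gamma (of_real (2 - \<kappa> + real l)) =
    borel_const n0 * (\<Sum>i<r. R j i * dirichlet i (1 + of_nat l)) / (2 * of_real pi * \<i>) ^ l"
proof -
  define n where "n = l + n0"
  define S where "S = (\<Sum>i<r. R j i * dirichlet i (1 + of_nat l))"
  have "vmellin ((deriv ^^ n) (G j)) 0 (1/2) = vmellin ((deriv ^^ n) (G j)) 0 ((1/2 - of_nat n) + of_nat n)"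
    by simp
  also have "\<dots> = \<i> ^ n * pochhammer (1/2 - of_nat n) n * vmellin (G j) 0 (1/2 - of_nat n)"
    by (rule vmellin_higher_deriv[OF fourier_rapid[OF j]])
  also have "pochhammer (1/2 - of_nat n) n = (- 1) ^ n * pochhammer (1/2 :: complex) n"
    using pochhammer_minus[of "of_nat n - 1/2 :: complex" n] by (simp add: algebra_simps)
  also have "pochhammer (1/2 :: complex) n = Gamma (1/2 + of_nat n) / of_real (sqrt pi)"
    by (subst pochhammer_Gamma) (auto simp: Gamma_one_half_complex elim!: nonpos_Ints_cases dest: arg_cong[of _ _ Re])
  also have "vmellin (G j) 0 (1/2 - of_nat n) =
      \<i> powr of_real \<kappa> * ((2 * of_real pi) powr (- (1 + of_nat l)) * fact l * S)"
  proof -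
    have "of_real \<kappa> - (1/2 - of_nat n) = (1 + of_nat l :: complex)" by (simp add: \<kappa> n_def)
    moreover have "vmellin (G i) 0 (1 + of_nat l) = (2 * of_real pi) powr (- (1 + of_nat l)) * fact l * dirichlet i (1 + of_nat l)" if "i < r" for i
      using l weight_bounds mellin_eq_dirichlet[OF that, of "1 + of_nat l"] by (simp add: Gamma_fact)
    ultimately show ?thesis
      using mellin_functional_equation[OF j, of "1/2 - of_nat n"]
      by (simp add: S_def sum_distrib_left mult_ac)
  qed
  also have "(2 * complex_of_real pi) powr (- (1 + of_nat l)) = 1 / (2 * of_real pi) ^ Suc l"
  proof -
    have "complex_of_real (2 * pi) powr (- (1 + of_nat l)) = inverse (of_real (2 * pi) powr of_nat (Suc l))"
      unfolding powr_minus of_nat_Suc by (rule refl)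
    also have "complex_of_real (2 * pi) powr of_nat (Suc l) = of_real (2 * pi) ^ Suc l"
      by (rule powr_nat') simp
    finally show ?thesis by (simp add: inverse_eq_divide)
  qed
  finally have v: "vmellin ((deriv ^^ n) (G j)) 0 (1/2) = \<i> ^ n * ((- 1) ^ n * (Gamma (1/2 + of_nat n) / of_real (sqrt pi))) *
      (\<i> powr of_real \<kappa> * (1 / (2 * of_real pi) ^ Suc l * fact l * S))" by simp
  have g: "complex_of_real (2 - \<kappa> + real l) = 1/2 + of_nat n" by (simp add: \<kappa> n_def)
  have g0: "Gamma (1/2 + of_nat n :: complex) \<noteq> 0"
    unfolding Gamma_eq_zero_iff by (auto elim!: nonpos_Ints_cases dest: arg_cong[of _ _ Re])
  have alg: "s2 / a * (x * (y * (g / sp)) * (k * (1 / (tp * q) * f * S))) / f / g = s2 / sp * ((x * y) / (a * q)) * (k / tp) * S"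
    if "f \<noteq> 0" "g \<noteq> 0" for s2 a x y g sp k tp q f :: complex
    using that by (simp add: mult_ac)
  have "\<i> ^ n * (- 1) ^ n / ((2 * of_real pi * \<i>) ^ n0 * (2 * of_real pi) ^ l) =
      ((- \<i>) / (2 * of_real pi * \<i>)) ^ n0 * ((- \<i>) / (2 * of_real pi)) ^ l"
  proof -
    have "\<i> ^ n * (- 1) ^ n = (\<i> * - 1) ^ n" by (rule power_mult_distrib[symmetric])
    also have "\<dots> = (- \<i>) ^ n0 * (- \<i>) ^ l" unfolding n_def mult_minus1_right power_add by (rule mult.commute)
    finally show ?thesis by (simp only: power_divide times_divide_times_eq)
  qed
  also have "(- \<i>) / (2 * of_real pi * \<i>) = of_real (- 1 / (2 * pi))" by simp
  also have "(- \<i>) / (2 * of_real pi) = 1 / (2 * of_real pi * \<i>)" by (simp add: field_simps)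
  finally have eq: "\<i> ^ n * (- 1) ^ n / ((2 * of_real pi * \<i>) ^ n0 * (2 * of_real pi) ^ l) =
      of_real (- 1 / (2 * pi)) ^ n0 * (1 / (2 * of_real pi * \<i>)) ^ l" .
  show ?thesis
    unfolding asymptotic_coeff_def n_def[symmetric] v g power_Suc
    unfolding alg[OF fact_nonzero g0] eq borel_const_def S_def[symmetric] \<kappa>[symmetric]
    by (simp add: power_divide)
qed

end

section \<open>Partial fractions with poles on a lattice\<close>

text \<open>
  With \<open>\<mu> = freq D m\<close> the summand is \<open>\<beta> m * (1 / (\<mu> - w) - 1 / \<mu>)\<close>; subtracting \<open>1 / \<mu>\<close> makes the
  series converge absolutely for coefficients \<open>O(\<mu>^(\<kappa>/2))\<close> with \<open>\<kappa> < 2\<close>.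
\<close>
definition pole_series :: "nat \<Rightarrow> (nat \<Rightarrow> complex) \<Rightarrow> complex \<Rightarrow> complex" where
  "pole_series D \<beta> w = (\<Sum>m. \<beta> m * (w / (of_real (freq D m) * (of_real (freq D m) - w))))"

locale pole_coefficients =
  fixes D :: nat and \<beta> :: "nat \<Rightarrow> complex"
  assumes D: "D > 0" and summable: "summable (\<lambda>m. cmod (\<beta> m) * freq D m powr (- 2))"
begin

abbreviation \<mu> :: "nat \<Rightarrow> real" where "\<mu> \<equiv> freq D"
abbreviation pole_term :: "nat \<Rightarrow> complex \<Rightarrow> complex" where
  "pole_term m w \<equiv> \<beta> m * (w / (of_real (\<mu> m) * (of_real (\<mu> m) - w)))"

lemma pos: "\<mu> m > 0" using D by (simp add: freq_def)

lemma mono: "m \<le> n \<Longrightarrow> \<mu> m \<le> \<mu> n" by (simp add: freq_def divide_right_mono)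

text \<open>
  The factor \<open>1 - \<rho> / \<mu> M\<close> bounds \<open>\<bar>\<mu> m - w\<bar> / \<mu> m\<close> from below for all \<open>m \<ge> M\<close> at once.
\<close>
lemma pole_term_le:
  assumes w: "cmod w \<le> \<rho>" and \<rho>: "\<rho> < \<mu> M" and m: "M \<le> m"
  shows "cmod (pole_term m w) \<le> (\<rho> / (1 - \<rho> / \<mu> M)) * (cmod (\<beta> m) * \<mu> m powr (- 2))"
proof -
  have \<rho>0: "\<rho> \<ge> 0" using w norm_ge_zero order_trans by blast
  have d0: "1 - \<rho> / \<mu> M > 0" using \<rho> pos[of M] by simp
  have "\<mu> m * (\<rho> / \<mu> M) \<ge> \<rho>"
    using mono[OF m] pos[of M] \<rho>0 by (simp add: field_simps mult_left_mono)
  then have "\<mu> m * (1 - \<rho> / \<mu> M) \<le> \<mu> m - cmod w"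
    using w by (simp add: right_diff_distrib)
  also have "\<dots> \<le> cmod (of_real (\<mu> m) - w)"
    using norm_triangle_ineq2[of "of_real (\<mu> m)" w] pos[of m] by simp
  finally have d: "\<mu> m * (1 - \<rho> / \<mu> M) \<le> cmod (of_real (\<mu> m) - w)" .
  have "cmod (w / (of_real (\<mu> m) * (of_real (\<mu> m) - w))) = cmod w / (\<mu> m * cmod (of_real (\<mu> m) - w))"
    using pos[of m] by (simp add: norm_divide norm_mult)
  also have "\<dots> \<le> \<rho> / (\<mu> m * (\<mu> m * (1 - \<rho> / \<mu> M)))"
    using w \<rho>0 d d0 pos[of m] by (intro frac_le mult_left_mono mult_pos_pos) auto
  also have "\<dots> = (\<rho> / (1 - \<rho> / \<mu> M)) * \<mu> m powr (- 2)"
    using pos[of m] by (simp add: powr_minus_divide powr_numeral power2_eq_square)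
  finally show ?thesis
    by (simp only: norm_mult mult.left_commute mult_left_mono norm_ge_zero)
qed

lemma pole_term_summable: "summable (\<lambda>m. cmod (pole_term m w))"
proof -
  obtain M where M: "cmod w * real D < real M" using reals_Archimedean2 by blast
  then have "cmod w < \<mu> M" using D by (simp add: freq_def field_simps)
  then show ?thesis
    using pole_term_le[of w "cmod w" M]
    by (intro summable_comparison_test[OF _ summable_mult[OF summable, of "cmod w / (1 - cmod w / \<mu> M)"]])
       (auto simp: eventually_sequentially)
qed

lemma pole_series_split:
  "pole_series D \<beta> w = (\<Sum>m<M. pole_term m w) + (\<Sum>m. pole_term (m + M) w)"
  unfolding pole_series_def
  using suminf_split_initial_segment[OF summable_norm_cancel[OF pole_term_summable], of w M] by simp

lemma pole_series_tail_holomorphic: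
  "(\<lambda>w. \<Sum>m. pole_term (m + M) w) holomorphic_on ball 0 (\<mu> M)"
proof (rule holomorphic_uniform_sequence[where f = "\<lambda>N w. \<Sum>m<N. pole_term (m + M) w"])
  have "of_real (\<mu> (m + M)) \<noteq> w" if "w \<in> ball 0 (\<mu> M)" for m and w :: complex
    using that mono[of M "m + M"] pos[of "m + M"] by auto
  then show "(\<lambda>w. \<Sum>m<N. pole_term (m + M) w) holomorphic_on ball 0 (\<mu> M)" for N
    using pos by (intro holomorphic_intros) (force simp: less_le)+
  fix x :: complex assume x: "x \<in> ball 0 (\<mu> M)"
  define \<rho> where "\<rho> = (cmod x + \<mu> M) / 2"
  have \<rho>: "\<rho> < \<mu> M" using x by (simp add: \<rho>_def)
  have sub: "cmod w \<le> \<rho>" if "w \<in> cball x (\<rho> - cmod x)" for w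
    using that norm_triangle_ineq2[of w x] by (simp add: dist_norm norm_minus_commute)
  have "uniform_limit (cball x (\<rho> - cmod x)) (\<lambda>N w. \<Sum>m<N. pole_term (m + M) w)
      (\<lambda>w. \<Sum>m. pole_term (m + M) w) sequentially"
  proof (rule Weierstrass_m_test)
    show "summable (\<lambda>m. (\<rho> / (1 - \<rho> / \<mu> M)) * (cmod (\<beta> (m + M)) * \<mu> (m + M) powr (- 2)))"
      using summable by (intro summable_mult summable_ignore_initial_segment)
    show "cmod (pole_term (m + M) w) \<le> (\<rho> / (1 - \<rho> / \<mu> M)) * (cmod (\<beta> (m + M)) * \<mu> (m + M) powr (- 2))"
      if "w \<in> cball x (\<rho> - cmod x)" for m w
      by (rule pole_term_le[OF sub[OF that] \<rho>]) simp
  qed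
  then show "\<exists>d>0. cball x d \<subseteq> ball 0 (\<mu> M) \<and> uniform_limit (cball x d)
      (\<lambda>N w. \<Sum>m<N. pole_term (m + M) w) (\<lambda>w. \<Sum>m. pole_term (m + M) w) sequentially"
    using \<rho> sub x by (intro exI[of _ "\<rho> - cmod x"]) (fastforce simp: \<rho>_def)
qed auto

lemma pole_series_tail_analytic:
  assumes "cmod w < \<mu> M"
  shows "(\<lambda>w. \<Sum>m. pole_term (m + M) w) analytic_on {w}"
proof -
  have "(\<lambda>w. \<Sum>m. pole_term (m + M) w) analytic_on ball 0 (\<mu> M)"
    by (simp only: analytic_on_open[OF open_ball] pole_series_tail_holomorphic)
  then show ?thesis by (rule analytic_on_subset) (use assms in auto)
qed

lemma obtain_tail:
  obtains M where "k < M" "cmod w < \<mu> M"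
proof -
  obtain M where M: "cmod w * real D < real M" using reals_Archimedean2 by blast
  then have "cmod w < \<mu> M" using D by (simp add: freq_def field_simps)
  also have "\<mu> M \<le> \<mu> (M + Suc k)" by (rule mono) simp
  finally show ?thesis using that[of "M + Suc k"] by simp
qed

lemma pole_series_analytic:
  assumes "w \<notin> range (\<lambda>m. of_real (\<mu> m))"
  shows "pole_series D \<beta> analytic_on {w}"
proof -
  obtain M where M: "cmod w < \<mu> M" using obtain_tail by blast
  have "(\<lambda>w. \<Sum>m. pole_term (m + M) w) analytic_on {w}"
    by (rule pole_series_tail_analytic) (rule M)
  moreover have "of_real (\<mu> m) \<noteq> w" for m using assms by auto
  ultimately show ?thesis
    unfolding pole_series_split[of _ M] using pos
    by (intro analytic_intros) (auto simp: less_le pos[THEN less_imp_neq, THEN not_sym])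
qed

lemma pole_series_at_pole:
  obtains u where "u analytic_on {of_real (\<mu> k)}" "u (of_real (\<mu> k)) = \<beta> k"
    "\<And>w. w \<noteq> of_real (\<mu> k) \<Longrightarrow> pole_series D \<beta> w = u w / (of_real (\<mu> k) - w)"
proof -
  let ?w = "complex_of_real (\<mu> k)"
  obtain M where M: "k < M" "cmod ?w < \<mu> M" using obtain_tail by blast
  define h where "h = (\<lambda>w. (\<Sum>m\<in>{..<M}-{k}. pole_term m w) + (\<Sum>m. pole_term (m + M) w))"
  define u where "u = (\<lambda>w. \<beta> k * (w / ?w) + (?w - w) * h w)"
  have "(\<lambda>w. \<Sum>m. pole_term (m + M) w) analytic_on {?w}"
    by (rule pole_series_tail_analytic) (rule M(2))
  moreover have "of_real (\<mu> m) \<noteq> ?w" if "m \<noteq> k" for m using that D by (simp add: freq_def)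
  ultimately have "u analytic_on {?w}"
    unfolding u_def h_def using pos
    by (intro analytic_intros) (auto simp: pos[THEN less_imp_neq, THEN not_sym])
  moreover have "u ?w = \<beta> k" using pos[of k] by (simp add: u_def)
  moreover have "pole_series D \<beta> w = u w / (?w - w)" if "w \<noteq> ?w" for w
  proof -
    have "pole_series D \<beta> w = pole_term k w + h w"
      unfolding pole_series_split[of _ M] h_def using M(1)
      by (subst sum.remove[of _ k]) auto
    also have "\<dots> = u w / (?w - w)"
      using that pos[of k] by (simp add: u_def add_divide_distrib)
    finally show ?thesis .
  qed
  ultimately show ?thesis using that by blast
qed

text \<open>
  The powers of \<open>w\<close> come from the geometric series of each term. Its partial sums have a closed form, and
  after summation over \<open>m\<close> the remainder is the original series with \<open>(w / \<mu> m)^N\<close> inserted, which is at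
  most a constant times \<open>(\<bar>w\<bar> / \<mu> 0)^N\<close>; only finitely many powers are ever interchanged with the
  infinite sum.
\<close>
lemma pole_series_power_series:
  assumes w: "cmod w < 1 / real D"
  shows "(\<lambda>l. (\<Sum>m. \<beta> m * of_real (\<mu> m) powr (- (2 + of_nat l))) * w ^ Suc l) sums pole_series D \<beta> w"
proof -
  define t where "t = (\<lambda>l m. \<beta> m * (w ^ Suc l / of_real (\<mu> m) ^ (l + 2)))"
  have w0: "cmod w < \<mu> 0" using w by (simp add: freq_def)
  have ne: "of_real (\<mu> m) \<noteq> w" for m
    using w0 mono[of 0 m] pos[of m] by auto
  have powr_eq: "of_real (\<mu> m) powr (- (2 + of_nat l)) = 1 / complex_of_real (\<mu> m) ^ (l + 2)" for m l
  proof -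
    have "complex_of_real (\<mu> m) powr (- (of_nat (l + 2))) = inverse (of_real (\<mu> m) powr of_nat (l + 2))"
      by (rule powr_minus)
    also have "complex_of_real (\<mu> m) powr of_nat (l + 2) = of_real (\<mu> m) ^ (l + 2)"
      by (rule powr_nat') simp
    finally show ?thesis by (simp add: inverse_eq_divide add.commute)
  qed
  have le: "cmod w / \<mu> m \<le> cmod w / \<mu> 0" for m
    using mono[of 0 m] pos[of 0] by (intro divide_left_mono) auto
  have lt1: "cmod w / \<mu> 0 < 1" using w0 pos[of 0] by simp
  have norm_t: "cmod (t l m) \<le> (cmod w * (cmod w / \<mu> 0) ^ l) * (cmod (\<beta> m) * \<mu> m powr (- 2))" for l m
  proof -
    have "cmod (t l m) = (cmod w * (cmod w / \<mu> m) ^ l) * (cmod (\<beta> m) * \<mu> m powr (- 2))"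
      using pos[of m] by (simp add: t_def norm_mult norm_divide norm_power powr_minus_divide powr_numeral power_add
          power_divide power2_eq_square mult_ac)
    also have "\<dots> \<le> (cmod w * (cmod w / \<mu> 0) ^ l) * (cmod (\<beta> m) * \<mu> m powr (- 2))"
      using le[of m] pos[of m] by (intro mult_right_mono mult_left_mono power_mono) auto
    finally show ?thesis .
  qed
  have tsum: "summable (t l)" for l
    by (rule summable_norm_cancel, rule summable_comparison_test[OF _ summable_mult[OF summable]])
       (use norm_t in auto)
  have coeff: "(\<Sum>m. \<beta> m * of_real (\<mu> m) powr (- (2 + of_nat l))) * w ^ Suc l = (\<Sum>m. t l m)" for l
  proof -
    have "summable (\<lambda>m. \<beta> m * (1 / of_real (\<mu> m) ^ (l + 2)))"
    proof (rule summable_norm_cancel, rule summable_comparison_test[OF _ summable_mult[OF summable, of "1 / \<mu> 0 ^ l"]], intro exI allI impI)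
      fix m
      have "1 / \<mu> m ^ l \<le> 1 / \<mu> 0 ^ l" using mono[of 0 m] pos[of 0] by (intro divide_left_mono power_mono) auto
      then have "1 / \<mu> m ^ l * (cmod (\<beta> m) * \<mu> m powr (- 2)) \<le> 1 / \<mu> 0 ^ l * (cmod (\<beta> m) * \<mu> m powr (- 2))"
        by (intro mult_right_mono) auto
      then show "norm (cmod (\<beta> m * (1 / of_real (\<mu> m) ^ (l + 2)))) \<le> 1 / \<mu> 0 ^ l * (cmod (\<beta> m) * \<mu> m powr (- 2))"
        using pos[of m] by (simp add: norm_mult norm_divide norm_power powr_minus_divide powr_numeral power_add
            power2_eq_square mult_ac)
    qed
    from suminf_mult2[OF this, of "w ^ Suc l"] show ?thesis unfolding powr_eq t_def by simp
  qed
  define C where "C = (\<Sum>m. cmod (pole_term m w))"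
  have rem: "cmod (pole_series D \<beta> w - (\<Sum>l<N. \<Sum>m. t l m)) \<le> C * (cmod w / \<mu> 0) ^ N" for N
  proof -
    have geo: "pole_term m w - (\<Sum>l<N. t l m) = pole_term m w * (w / of_real (\<mu> m)) ^ N" for m
    proof -
      have ne0: "complex_of_real (\<mu> m) \<noteq> 0" using pos[of m] by simp
      have q: "w / of_real (\<mu> m) \<noteq> 1" using ne[of m] ne0 by (auto simp: divide_eq_1_iff)
      have "(\<Sum>l<N. t l m) = \<beta> m * (w / of_real (\<mu> m) ^ 2) * (\<Sum>l<N. (w / of_real (\<mu> m)) ^ l)"
        unfolding sum_distrib_left t_def
        by (rule sum.cong) (auto simp: power_divide power_add power2_eq_square mult_ac)
      also have "(\<Sum>l<N. (w / of_real (\<mu> m)) ^ l) = ((w / of_real (\<mu> m)) ^ N - 1) / (w / of_real (\<mu> m) - 1)"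
        by (rule geometric_sum[OF q])
      also have "\<beta> m * (w / of_real (\<mu> m) ^ 2) * (((w / of_real (\<mu> m)) ^ N - 1) / (w / of_real (\<mu> m) - 1))
          = pole_term m w * (1 - (w / of_real (\<mu> m)) ^ N)"
      proof -
        have "(x / a ^ 2) * ((Q - 1) / (x / a - 1)) = (x / (a * (a - x))) * (1 - Q)"
          if "a \<noteq> 0" "a \<noteq> x" for x a Q :: complex
        proof -
          have "x / a - 1 = - (a - x) / a" using that by (simp add: field_simps)
          then show ?thesis using that by (simp add: power2_eq_square divide_simps) (simp add: algebra_simps)
        qed
        from this[OF ne0 ne[of m]] show ?thesis by (simp only: mult.assoc)
      qed
      finally show ?thesis by (simp add: right_diff_distrib)
    qed
    have "pole_series D \<beta> w - (\<Sum>l<N. \<Sum>m. t l m) = (\<Sum>m. pole_term m w - (\<Sum>l<N. t l m))"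
    proof -
      have "(\<Sum>l<N. \<Sum>m. t l m) = (\<Sum>m. \<Sum>l<N. t l m)" by (rule suminf_sum[symmetric]) (rule tsum)
      moreover have "summable (\<lambda>m. \<Sum>l<N. t l m)" by (intro summable_sum tsum)
      ultimately show ?thesis
        unfolding pole_series_def
        using suminf_diff[OF summable_norm_cancel[OF pole_term_summable[of w]]] by simp
    qed
    also have "\<dots> = (\<Sum>m. pole_term m w * (w / of_real (\<mu> m)) ^ N)" unfolding geo ..
    also have "cmod \<dots> \<le> (\<Sum>m. cmod (pole_term m w) * (cmod w / \<mu> 0) ^ N)"
    proof (rule norm_suminf_le)
      show "cmod (pole_term m w * (w / of_real (\<mu> m)) ^ N) \<le> cmod (pole_term m w) * (cmod w / \<mu> 0) ^ N" for m
        unfolding norm_mult norm_power norm_divide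
        using le[of m] pos[of m] by (intro mult_left_mono power_mono) (auto simp: norm_divide)
    qed (intro summable_mult2 pole_term_summable)
    also have "\<dots> = C * (cmod w / \<mu> 0) ^ N"
      unfolding C_def by (rule suminf_mult2[symmetric]) (rule pole_term_summable)
    finally show ?thesis .
  qed
  have "(\<lambda>N. C * (cmod w / \<mu> 0) ^ N) \<longlonglongrightarrow> C * 0"
    using lt1 pos[of 0] by (intro tendsto_intros LIMSEQ_realpow_zero) auto
  then have "(\<lambda>N. pole_series D \<beta> w - (\<Sum>l<N. \<Sum>m. t l m)) \<longlonglongrightarrow> 0"
    by (intro Lim_null_comparison[OF always_eventually[OF allI[OF rem]]]) simp
  then have "(\<lambda>N. \<Sum>l<N. \<Sum>m. t l m) \<longlonglongrightarrow> pole_series D \<beta> w"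
    using tendsto_diff[OF tendsto_const[of "pole_series D \<beta> w"]] by fastforce
  then show ?thesis unfolding sums_def coeff .
qed

end

section \<open>The Borel transform as a partial fraction series\<close>

lemma stokes_point_div: "stokes_point x / (2 * of_real pi * \<i>) = of_real x"
  by (simp add: stokes_point_def)

lemma stokes_point_powr:
  assumes "x > 0"
  shows "stokes_point x powr p = (2 * of_real pi * \<i>) powr p * of_real x powr p"
proof -
  have "Ln (of_real x * (2 * of_real pi * \<i>)) = of_real (ln x) + Ln (2 * of_real pi * \<i>)"
    using Ln_times_of_real[of x "2 * of_real pi * \<i>"] assms by (simp add: Ln_of_real)
  then show ?thesis using assms
    by (simp add: stokes_point_def powr_def Ln_of_real mult.commute distrib_left exp_add)
qed

text \<open>
  When \<open>u a = 0\<close> the singularity is removable, so the order is \<open>- 1\<close> only under the assumption that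
  there is a pole. This is how vanishing Stokes vectors are accommodated.
\<close>
lemma simple_pole_dichotomy:
  assumes u: "u analytic_on {a}" and f: "\<And>z. z \<noteq> a \<Longrightarrow> f z = u z / (z - a)"
  shows "f meromorphic_on {a}" and "is_pole f a \<Longrightarrow> zorder f a = - 1"
    and "\<exists>h. h analytic_on {a} \<and> (\<forall>\<^sub>F z in at a. f z = u a / (z - a) + h z)"
proof -
  have ev: "\<forall>\<^sub>F z in at a. f z = u z / (z - a)"
    using f by (auto simp: eventually_at intro: exI[of _ 1])
  have "(\<lambda>z. u z / (z - a)) meromorphic_on {a}"
    by (intro meromorphic_on_divide analytic_on_imp_meromorphic_on u analytic_intros)
  then show "f meromorphic_on {a}"
    using meromorphic_on_cong[of "{a}" f "\<lambda>z. u z / (z - a)"] ev by auto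
  define h where "h = (\<lambda>z. if z = a then deriv u a else f z - u a / (z - a))"
  have h: "h analytic_on {a}" unfolding h_def
    by (rule pole_theorem_analytic[OF u]) (auto simp: f intro: exI[of _ 1])
  have evh: "\<forall>\<^sub>F z in at a. f z = u a / (z - a) + h z"
    by (auto simp: eventually_at h_def intro: exI[of _ 1])
  with h show "\<exists>h. h analytic_on {a} \<and> (\<forall>\<^sub>F z in at a. f z = u a / (z - a) + h z)" by blast
  assume pole: "is_pole f a"
  have "u a \<noteq> 0"
  proof
    assume "u a = 0"
    then have "is_pole h a" using is_pole_transform[OF pole, of h a] evh by simp
    then show False using analytic_at_imp_no_pole[OF h] by blast
  qed
  moreover obtain S where "open S" "a \<in> S" "u holomorphic_on S" using u analytic_at by blast
  ultimately show "zorder f a = - 1"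
    by (intro zorder_eqI[of S a u]) (auto simp: f divide_inverse power_int_minus)
qed

context pole_coefficients
begin

abbreviation borel_function :: "complex \<Rightarrow> complex \<Rightarrow> complex \<Rightarrow> complex" where
  "borel_function c K \<xi> \<equiv> c + K * pole_series D \<beta> (\<xi> / (2 * of_real pi * \<i>))"

lemma borel_function_analytic:
  assumes "\<xi> \<notin> range (\<lambda>m. stokes_point (\<mu> m))"
  shows "borel_function c K analytic_on {\<xi>}"
proof -
  have "\<xi> / (2 * of_real pi * \<i>) \<notin> range (\<lambda>m. of_real (\<mu> m))"
    using assms by (auto simp: stokes_point_def field_simps)
  then have "pole_series D \<beta> analytic_on {\<xi> / (2 * of_real pi * \<i>)}" by (rule pole_series_analytic)
  then have "(pole_series D \<beta> \<circ> (\<lambda>\<xi>. \<xi> / (2 * of_real pi * \<i>))) analytic_on {\<xi>}"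
    by (intro analytic_on_compose analytic_intros) auto
  then show ?thesis by (intro analytic_intros) (simp add: comp_def)
qed

lemma borel_function_at_pole:
  obtains u where "u analytic_on {stokes_point (\<mu> k)}" "u (stokes_point (\<mu> k)) = - (2 * of_real pi * \<i>) * K * \<beta> k"
    "\<And>\<xi>. \<xi> \<noteq> stokes_point (\<mu> k) \<Longrightarrow> borel_function c K \<xi> = u \<xi> / (\<xi> - stokes_point (\<mu> k))"
proof -
  let ?t = "2 * of_real pi * \<i> :: complex"
  let ?x = "stokes_point (\<mu> k)"
  obtain v where v: "v analytic_on {of_real (\<mu> k)}" "v (of_real (\<mu> k)) = \<beta> k"
    "\<And>w. w \<noteq> of_real (\<mu> k) \<Longrightarrow> pole_series D \<beta> w = v w / (of_real (\<mu> k) - w)"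
    using pole_series_at_pole by blast
  define u where "u = (\<lambda>\<xi>. c * (\<xi> - ?x) + - ?t * K * v (\<xi> / ?t))"
  have "(v \<circ> (\<lambda>\<xi>. \<xi> / ?t)) analytic_on {?x}"
    using v(1) by (intro analytic_on_compose analytic_intros) (auto simp: stokes_point_div)
  then have "u analytic_on {?x}" unfolding u_def by (intro analytic_intros) (simp add: comp_def)
  moreover have "u ?x = - ?t * K * \<beta> k" by (simp add: u_def stokes_point_div v(2))
  moreover have "borel_function c K \<xi> = u \<xi> / (\<xi> - ?x)" if "\<xi> \<noteq> ?x" for \<xi>
  proof -
    have ne: "\<xi> / ?t \<noteq> of_real (\<mu> k)" using that by (auto simp: stokes_point_def field_simps)
    have d: "of_real (\<mu> k) - \<xi> / ?t = - (\<xi> - ?x) / ?t" by (simp add: stokes_point_def field_simps)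
    have alg: "c + K * (V / (- y / t)) = (c * y + - t * K * V) / y" if "y \<noteq> 0" "t \<noteq> 0" for c K V y t :: complex
      using that by (simp add: field_simps)
    show ?thesis
      unfolding v(3)[OF ne] u_def d by (rule alg) (use that in auto)
  qed
  ultimately show ?thesis using that by blast
qed

lemma borel_function_meromorphic: "borel_function c K meromorphic_on A"
  unfolding meromorphic_on_meromorphic_at[of _ A]
proof
  fix \<xi>
  show "borel_function c K meromorphic_on {\<xi>}"
  proof (cases "\<xi> \<in> range (\<lambda>m. stokes_point (\<mu> m))")
    case True
    then obtain k where k: "\<xi> = stokes_point (\<mu> k)" by blast
    obtain u where "u analytic_on {\<xi>}" "\<And>z. z \<noteq> \<xi> \<Longrightarrow> borel_function c K z = u z / (z - \<xi>)"
      unfolding k using borel_function_at_pole[of k K c] by blast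
    then show ?thesis by (rule simple_pole_dichotomy(1))
  qed (auto intro: analytic_on_imp_meromorphic_on borel_function_analytic)
qed

lemma borel_function_poles:
  assumes "is_pole (borel_function c K) \<xi>"
  shows "\<xi> \<in> range (\<lambda>m. stokes_point (\<mu> m)) \<and> zorder (borel_function c K) \<xi> = - 1"
proof -
  obtain k where k: "\<xi> = stokes_point (\<mu> k)"
    using assms borel_function_analytic analytic_at_imp_no_pole by blast
  obtain u where u: "u analytic_on {\<xi>}"
      "\<And>z. z \<noteq> \<xi> \<Longrightarrow> borel_function c K z = u z / (z - \<xi>)"
    unfolding k using borel_function_at_pole[of k K c] by blast
  have "zorder (borel_function c K) \<xi> = - 1" by (rule simple_pole_dichotomy(2)[OF u assms])
  then show ?thesis using k by simp
qed

text \<open>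
  The branch factor \<open>\<xi>^p\<close> is analytic at the poles because they lie on the positive imaginary axis, away
  from the cut of the principal logarithm; it contributes its value there to the residue.
\<close>
lemma borel_function_local_form:
  "\<exists>h. h analytic_on {stokes_point (\<mu> k)} \<and>
     (\<forall>\<^sub>F \<xi> in at (stokes_point (\<mu> k)). \<xi> powr of_real p * borel_function c K \<xi> =
        - ((2 * of_real pi * \<i>)\<^sup>2 * (2 * of_real pi * \<i>) powr of_real p * K * of_real (\<mu> k powr p) * \<beta> k
            / (2 * of_real pi * \<i> * (\<xi> - stokes_point (\<mu> k)))) + h \<xi>)"
proof -
  let ?x = "stokes_point (\<mu> k)"
  obtain u where u: "u analytic_on {?x}" "u ?x = - (2 * of_real pi * \<i>) * K * \<beta> k"
    "\<And>\<xi>. \<xi> \<noteq> ?x \<Longrightarrow> borel_function c K \<xi> = u \<xi> / (\<xi> - ?x)"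
    using borel_function_at_pole[of k K c] by blast
  have "?x \<notin> \<real>\<^sub>\<le>\<^sub>0" using pos[of k] by (auto simp: stokes_point_def complex_nonpos_Reals_iff)
  then have "(\<lambda>\<xi>. \<xi> powr of_real p * u \<xi>) analytic_on {?x}"
    using u(1) by (intro analytic_intros) auto
  moreover have "\<xi> powr of_real p * borel_function c K \<xi> = \<xi> powr of_real p * u \<xi> / (\<xi> - ?x)" if "\<xi> \<noteq> ?x" for \<xi>
    using u(3)[OF that] by simp
  ultimately obtain h where h: "h analytic_on {?x}" "\<forall>\<^sub>F \<xi> in at ?x. \<xi> powr of_real p * borel_function c K \<xi> =
      ?x powr of_real p * u ?x / (\<xi> - ?x) + h \<xi>"
    using simple_pole_dichotomy(3)[of "\<lambda>\<xi>. \<xi> powr of_real p * u \<xi>" ?x "\<lambda>\<xi>. \<xi> powr of_real p * borel_function c K \<xi>"]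
    by blast
  have "complex_of_real (\<mu> k) powr of_real p = of_real (\<mu> k powr p)"
    using pos[of k] by (intro powr_of_real) auto
  then have "?x powr of_real p * u ?x / (\<xi> - ?x) =
     - ((2 * of_real pi * \<i>)\<^sup>2 * (2 * of_real pi * \<i>) powr of_real p * K * of_real (\<mu> k powr p) * \<beta> k
            / (2 * of_real pi * \<i> * (\<xi> - ?x)))" for \<xi>
  proof -
    have alg: "P * M * (- t * K * b) / y = - (t\<^sup>2 * P * K * M * b / (t * y))" if "t \<noteq> 0" for P M t K b y :: complex
      using that by (simp add: power2_eq_square mult_ac)
    have "(2 * of_real pi * \<i> :: complex) \<noteq> 0" by simp
    from alg[OF this] show ?thesis
      unfolding u(2) stokes_point_powr[OF pos] \<open>complex_of_real (\<mu> k) powr of_real p = of_real (\<mu> k powr p)\<close> .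
  qed
  with h show ?thesis by auto
qed

text \<open>
  The expansion of the partial fraction series starts with the first power of \<open>w\<close>, so the coefficient
  with \<open>l = 0\<close> is matched by the additive constant alone.
\<close>
lemma borel_sums:
  assumes c0: "c 0 / Gamma (of_real p) = b"
    and cl: "\<And>l. l \<ge> 1 \<Longrightarrow> c l / Gamma (of_real (p + real l)) =
        K * (\<Sum>m. \<beta> m * of_real (\<mu> m) powr (- (1 + of_nat l))) / (2 * of_real pi * \<i>) ^ l"
    and \<xi>: "\<xi> \<noteq> 0" "cmod \<xi> < 2 * pi / real D"
  shows "(\<lambda>l. c l * borel_monomial (p + real l) \<xi>) sums (\<xi> powr of_real (p - 1) * borel_function b K \<xi>)"
proof -
  define w where "w = \<xi> / (2 * of_real pi * \<i>)"
  have w: "cmod w < 1 / real D" using \<xi>(2) D by (simp add: w_def norm_divide norm_mult field_simps)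
  define f where "f = (\<lambda>l. if l = 0 then b else K * ((\<Sum>m. \<beta> m * of_real (\<mu> m) powr (- (1 + of_nat l))) * w ^ l))"
  have "(\<lambda>l. f (Suc l)) sums (K * pole_series D \<beta> w)"
    using sums_mult[OF pole_series_power_series[OF w], of K] by (simp add: f_def)
  then have "f sums (K * pole_series D \<beta> w + f 0)" by (rule sums_Suc)
  then have "(\<lambda>l. \<xi> powr of_real (p - 1) * f l) sums (\<xi> powr of_real (p - 1) * borel_function b K \<xi>)"
    by (intro sums_mult) (simp add: f_def w_def add.commute)
  moreover have "c l * borel_monomial (p + real l) \<xi> = \<xi> powr of_real (p - 1) * f l" for l
  proof -
    have "\<xi> powr of_real (p + real l - 1) = \<xi> powr (of_real (p - 1) + of_nat l)"
      by (simp add: algebra_simps)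
    also have "\<dots> = \<xi> powr of_real (p - 1) * \<xi> ^ l"
      unfolding powr_add using \<xi>(1) by (simp add: powr_nat')
    finally have "c l * borel_monomial (p + real l) \<xi> =
        \<xi> powr of_real (p - 1) * (c l / Gamma (of_real (p + real l)) * \<xi> ^ l)"
      by (simp add: borel_monomial_def)
    also have "c l / Gamma (of_real (p + real l)) * \<xi> ^ l = f l"
      using c0 cl[of l] by (cases "l = 0") (auto simp: f_def w_def power_divide)
    finally show ?thesis .
  qed
  ultimately show ?thesis by simp
qed

end

section \<open>The exponent lattice and the Stokes points\<close>

lemma det_mat_2:
  assumes "A \<in> carrier_mat 2 2"
  shows "Determinant.det A = A $$ (0,0) * A $$ (1,1) - A $$ (0,1) * A $$ (1,0 :: nat)"
  using assms
  by (subst laplace_expansion_column[of A 2 0])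
     (auto simp: cofactor_def det_single mat_delete_def numeral_2_eq_2 lessThan_Suc)

lemma S_mat_entries: "S_mat $$ (0,0) = 0" "S_mat $$ (0,1) = - 1" "S_mat $$ (1,0) = 1" "S_mat $$ (1,1) = 0"
  by (simp_all add: S_mat_def mat_of_rows_list_def)

lemma S_mat_in_SL2Z: "S_mat \<in> SL2Z"
proof -
  have c: "S_mat \<in> carrier_mat 2 2"
    by (rule carrier_matI) (simp_all add: S_mat_def mat_of_rows_list_def)
  then show ?thesis
    unfolding SL2Z_def by (simp add: det_mat_2[OF c] S_mat_entries[simplified])
qed

lemma common_denominator_works:
  assumes "\<forall>k<r. \<alpha> k \<in> \<rat>"
  shows "common_denominator r \<alpha> > 0 \<and> (\<forall>k<r. real (common_denominator r \<alpha>) * \<alpha> k \<in> \<int>)"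
  unfolding common_denominator_def
proof (rule LeastI_ex)
  show "\<exists>d. d > 0 \<and> (\<forall>k<r. real d * \<alpha> k \<in> \<int>)"
    using assms
  proof (induction r)
    case (Suc r)
    then obtain d where d: "d > 0" "\<forall>k<r. real d * \<alpha> k \<in> \<int>" by auto
    obtain p q where q: "q > 0" "\<alpha> r = of_int p / of_int q"
      using Suc.prems Rats_cases'[of "\<alpha> r"] by blast
    have e: "real (nat q) * \<alpha> r \<in> \<int>" using q by simp
    have "real (d * nat q) * \<alpha> k \<in> \<int>" if "k < Suc r" for k
    proof (cases "k = r")
      case True
      have "real d * (real (nat q) * \<alpha> r) \<in> \<int>" by (rule Ints_mult[OF Ints_of_nat e])
      then show ?thesis by (simp only: True of_nat_mult mult.assoc)
    next
      case False
      then have "real d * \<alpha> k \<in> \<int>" using d that by auto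
      then have "real (nat q) * (real d * \<alpha> k) \<in> \<int>" by (rule Ints_mult[OF Ints_of_nat])
      then show ?thesis by (simp add: mult_ac)
    qed
    then show ?case using d(1) q(1) by (intro exI[of _ "d * nat q"]) auto
  qed auto
qed

lemma exponents_subset_range_freq:
  assumes "D > 0" "real D * \<alpha> \<in> \<int>"
  shows "exponents \<alpha> \<subseteq> range (freq D)"
proof
  fix x assume "x \<in> exponents \<alpha>"
  then obtain n where x: "x > 0" "x = \<alpha> + real n" by (auto simp: exponents_def)
  obtain z where z: "real D * \<alpha> = of_int z" using assms(2) by (auto elim: Ints_cases)
  have "real D * x = of_int (z + int (D * n))" using x z by (simp add: distrib_left)
  moreover have "real D * x > 0" using assms x by simp
  ultimately have "z + int (D * n) > 0" by (simp only: of_int_0_less_iff)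
  then obtain m where "z + int (D * n) = int (Suc m)" by (metis pos_int_cases Suc_pred)
  then have "real D * x = real (Suc m)" using \<open>real D * x = _\<close> by simp
  then show "x \<in> range (freq D)" using assms(1) by (auto simp: freq_def field_simps intro!: image_eqI[of _ _ m])
qed

lemma inj_freq: "D > 0 \<Longrightarrow> inj (freq D)"
  by (auto simp: inj_on_def freq_def)

lemma has_sum_freq_iff:
  fixes f :: "real \<Rightarrow> complex"
  assumes "D > 0" and A: "A \<subseteq> {0<..}" "\<And>x. x \<notin> A \<Longrightarrow> f x = 0" and f: "\<And>x. x \<notin> range (freq D) \<Longrightarrow> f x = 0"
  shows "(f has_sum s) A \<longleftrightarrow> ((\<lambda>m. f (freq D m)) has_sum s) UNIV"
proof -
  have "(f has_sum s) A \<longleftrightarrow> (f has_sum s) (range (freq D))"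
    by (rule has_sum_cong_neutral) (use A f in auto)
  also have "\<dots> \<longleftrightarrow> ((f \<circ> freq D) has_sum s) UNIV"
    by (rule has_sum_reindex[OF inj_freq[OF assms(1)]])
  finally show ?thesis by (simp add: comp_def)
qed

lemma infsum_freq:
  fixes f :: "real \<Rightarrow> complex"
  assumes D: "D > 0" and f: "\<And>x. x \<notin> range (freq D) \<Longrightarrow> f x = 0"
    and sm: "summable (\<lambda>m. cmod (f (freq D m)))"
  shows "infsum f {0<..} = (\<Sum>m. f (freq D m))"
proof (rule infsumI)
  have "range (freq D) \<subseteq> {0<..}" using D by (auto simp: freq_def)
  then have "(f has_sum s) {0<..} \<longleftrightarrow> (f has_sum s) (range (freq D))" for s
    using f by (intro has_sum_cong_neutral) auto
  moreover have "((\<lambda>m. f (freq D m)) has_sum (\<Sum>m. f (freq D m))) UNIV"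
    by (rule norm_summable_imp_has_sum[OF sm]) (rule summable_sums[OF summable_norm_cancel[OF sm]])
  ultimately show "(f has_sum (\<Sum>m. f (freq D m))) {0<..}"
    by (simp add: has_sum_reindex[OF inj_freq[OF D]] comp_def)
qed

lemma summable_freq_powr:
  assumes "D > 0" "p < - 1"
  shows "summable (\<lambda>m. freq D m powr p)"
proof -
  have "summable (\<lambda>m. real (Suc m) powr p)"
    using assms(2) summable_Suc_iff[of "\<lambda>m. real m powr p"] by (simp add: summable_real_powr_iff)
  then have "summable (\<lambda>m. real (Suc m) powr p / real D powr p)" by (rule summable_divide)
  then show ?thesis using assms(1) by (simp add: freq_def powr_divide)
qed

lemma summable_of_bigo:
  fixes f :: "real \<Rightarrow> real"
  assumes D: "D > 0" and f: "f \<in> O(\<lambda>x. x powr q)" and "\<sigma> > 1 + q"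
  shows "summable (\<lambda>m. f (freq D m) * freq D m powr (- \<sigma>))"
proof (rule summable_comparison_test_bigo)
  have "filterlim (freq D) at_top sequentially"
    unfolding freq_def divide_inverse using D
    by (intro filterlim_at_top_mult_tendsto_pos[OF tendsto_const]
        filterlim_compose[OF filterlim_real_sequentially filterlim_Suc]) auto
  from landau_o.big.compose[OF f this]
  have "(\<lambda>m. f (freq D m) * freq D m powr (- \<sigma>)) \<in> O(\<lambda>m. freq D m powr q * freq D m powr (- \<sigma>))"
    by (intro landau_o.big.mult) auto
  then show "(\<lambda>m. f (freq D m) * freq D m powr (- \<sigma>)) \<in> O(\<lambda>m. freq D m powr (q - \<sigma>))"
    by (simp flip: powr_add)
  show "summable (\<lambda>m. norm (freq D m powr (q - \<sigma>)))"
    using summable_freq_powr[OF D, of "q - \<sigma>"] assms(3) by simp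
qed

lemma range_stokes_point_freq:
  "{stokes_point (real m / real D) | m::nat. m \<ge> 1} = range (\<lambda>m. stokes_point (freq D m))"
proof (intro equalityI subsetI)
  fix x assume "x \<in> {stokes_point (real m / real D) | m::nat. m \<ge> 1}"
  then obtain m where "m \<ge> 1" "x = stokes_point (real m / real D)" by blast
  then show "x \<in> range (\<lambda>m. stokes_point (freq D m))"
    by (intro image_eqI[of _ _ "m - 1"]) (auto simp: freq_def)
qed (force simp: freq_def)

lemma stokes_points_complement:
  assumes D: "D > 0"
  shows "open (- range (\<lambda>m. stokes_point (freq D m)))" "connected (- range (\<lambda>m. stokes_point (freq D m)))"
    "0 \<notin> range (\<lambda>m. stokes_point (freq D m))"
proof -
  have "closed (range (\<lambda>m. stokes_point (freq D m)))"
  proof (rule discrete_imp_closed[of "2 * pi / real D"], safe)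
    fix m n assume *: "dist (stokes_point (freq D n)) (stokes_point (freq D m)) < 2 * pi / real D"
    have "stokes_point (freq D n) - stokes_point (freq D m) = 2 * of_real pi * \<i> * of_real ((real n - real m) / real D)"
      by (simp add: stokes_point_def freq_def diff_divide_distrib add_divide_distrib ring_distribs)
    then have "dist (stokes_point (freq D n)) (stokes_point (freq D m)) = 2 * pi * (\<bar>real n - real m\<bar> / real D)"
      by (simp only: dist_norm norm_mult norm_of_real) simp
    with * D have "\<bar>real n - real m\<bar> < 1" by (simp add: field_simps)
    then have "n = m" by linarith
    then show "stokes_point (freq D n) = stokes_point (freq D m)" by simp
  qed (use D in simp)
  then show "open (- range (\<lambda>m. stokes_point (freq D m)))" by (rule open_Compl)
  have "path_connected (- range (\<lambda>m. stokes_point (freq D m)))"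
    by (rule path_connected_complement_countable) auto
  then show "connected (- range (\<lambda>m. stokes_point (freq D m)))" by (rule path_connected_imp_connected)
  show "0 \<notin> range (\<lambda>m. stokes_point (freq D m))" using D by (auto simp: stokes_point_def freq_def simp del: of_nat_Suc)
qed

context fourier_vector
begin

definition stokes_coeff :: "nat \<Rightarrow> nat \<Rightarrow> complex" where
  "stokes_coeff k m = (\<Sum>i<r. R k i * b i m)"

lemma stokes_coeff_norm_summable:
  assumes "\<sigma> > 1 + \<kappa> / 2"
  shows "summable (\<lambda>m. cmod (stokes_coeff k m) * \<mu> m powr (- \<sigma>))"
proof (rule summable_comparison_test)
  show "summable (\<lambda>m. \<Sum>i<r. cmod (R k i) * (cmod (b i m) * \<mu> m powr (- \<sigma>)))"
    using assms by (intro summable_sum summable_mult dirichlet_summable) auto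
  have "cmod (stokes_coeff k m) \<le> (\<Sum>i<r. cmod (R k i) * cmod (b i m))" for m
    unfolding stokes_coeff_def by (rule sum_norm_le) (simp add: norm_mult)
  then have "cmod (stokes_coeff k m) * \<mu> m powr (- \<sigma>) \<le> (\<Sum>i<r. cmod (R k i) * cmod (b i m)) * \<mu> m powr (- \<sigma>)" for m
    by (intro mult_right_mono) auto
  then show "\<exists>N. \<forall>n\<ge>N. norm (cmod (stokes_coeff k n) * \<mu> n powr (- \<sigma>)) \<le>
      (\<Sum>i<r. cmod (R k i) * (cmod (b i n) * \<mu> n powr (- \<sigma>)))"
    by (simp add: sum_distrib_right mult.assoc)
qed

lemma stokes_coeff_poles: "pole_coefficients D (stokes_coeff k)"
  using stokes_coeff_norm_summable[of 2] weight_bounds D by unfold_locales auto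

lemma norm_of_real_powr: "x > 0 \<Longrightarrow> cmod (of_real x powr s) = x powr Re s"
  by (simp add: norm_powr_real_powr)

lemma stokes_coeff_dirichlet:
  assumes s: "Re s > 1 + \<kappa> / 2"
  shows "(\<lambda>m. stokes_coeff k m * of_real (\<mu> m) powr (- s)) sums (\<Sum>i<r. R k i * dirichlet i s)"
proof -
  have "(\<lambda>m. R k i * (b i m * of_real (\<mu> m) powr (- s))) sums (R k i * dirichlet i s)" if "i < r" for i
  proof (intro sums_mult)
    have "summable (\<lambda>m. cmod (b i m * of_real (\<mu> m) powr (- s)))"
      using dirichlet_summable[OF that s] freq_pos by (simp add: norm_mult norm_of_real_powr)
    then show "(\<lambda>m. b i m * of_real (\<mu> m) powr (- s)) sums dirichlet i s"
      unfolding dirichlet_def by (intro summable_sums) (rule summable_norm_cancel)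
  qed
  then have "(\<lambda>m. \<Sum>i<r. R k i * (b i m * of_real (\<mu> m) powr (- s))) sums (\<Sum>i<r. R k i * dirichlet i s)"
    by (intro sums_sum) auto
  then show ?thesis by (simp add: stokes_coeff_def sum_distrib_right mult.assoc)
qed

definition borel_continuation :: "nat \<Rightarrow> complex \<Rightarrow> complex" where
  "borel_continuation k \<xi> = asymptotic_coeff k 0 / Gamma (of_real (2 - \<kappa>)) +
     borel_const n0 * pole_series D (stokes_coeff k) (\<xi> / (2 * of_real pi * \<i>))"

lemma borel_termwise:
  assumes k: "k < r"
  shows "\<forall>\<^sub>F \<xi> in at 0. (\<lambda>l. asymptotic_coeff k l * borel_monomial (2 - \<kappa> + real l) \<xi>) sums
           (\<xi> powr of_real (1 - \<kappa>) * borel_continuation k \<xi>)"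
proof -
  have cl: "asymptotic_coeff k l / Gamma (of_real (2 - \<kappa> + real l)) =
      borel_const n0 * (\<Sum>m. stokes_coeff k m * of_real (\<mu> m) powr (- (1 + of_nat l))) / (2 * of_real pi * \<i>) ^ l"
    if l: "l \<ge> 1" for l
    using asymptotic_coeff_eq[OF k l] stokes_coeff_dirichlet[of "1 + of_nat l" k] l weight_bounds
    by (simp add: sums_iff)
  have "(\<lambda>l. asymptotic_coeff k l * borel_monomial (2 - \<kappa> + real l) \<xi>) sums
           (\<xi> powr of_real (2 - \<kappa> - 1) * borel_continuation k \<xi>)" if "\<xi> \<noteq> 0" "cmod \<xi> < 2 * pi / real D" for \<xi>
    unfolding borel_continuation_def by (rule pole_coefficients.borel_sums[OF stokes_coeff_poles refl cl that])
  then show ?thesis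
    using D by (auto simp: eventually_at dist_norm intro!: exI[of _ "2 * pi / real D"])
qed

end

section \<open>Vector-valued cusp forms\<close>

locale vector_cusp_form =
  fixes r n0 D :: nat and \<kappa> :: real and \<rho> :: "int mat \<Rightarrow> complex mat" and \<alpha> :: "nat \<Rightarrow> real"
    and g :: "complex \<Rightarrow> complex vec" and a :: "real \<Rightarrow> complex vec"
  assumes n0: "n0 \<le> 1" and \<kappa>: "\<kappa> = 3/2 - real n0"
    and multiplier: "multiplier_system r \<kappa> \<rho>"
    and rational: "\<forall>k<r. \<alpha> k \<in> \<rat>"
    and D_eq: "D = common_denominator r \<alpha>"
    and cusp: "cusp_form r \<kappa> \<rho> \<alpha> g a"
begin

lemma D_pos: "D > 0" and D_int: "k < r \<Longrightarrow> real D * \<alpha> k \<in> \<int>"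
  using common_denominator_works[OF rational] by (auto simp: D_eq)

lemma exponents_freq: "k < r \<Longrightarrow> exponents (\<alpha> k) \<subseteq> range (freq D)"
  by (rule exponents_subset_range_freq[OF D_pos D_int])

lemma coeff_eq_0: "k < r \<Longrightarrow> x \<notin> exponents (\<alpha> k) \<Longrightarrow> a x $ k = 0"
  using cusp unfolding cusp_form_def by blast

lemma coeff_eq_0_freq: "k < r \<Longrightarrow> x \<notin> range (freq D) \<Longrightarrow> a x $ k = 0"
  using coeff_eq_0 exponents_freq by blast

lemma a_carrier: "a x \<in> carrier_vec r"
  using cusp unfolding cusp_form_def by blast

lemma S_carrier: "\<rho> S_mat \<in> carrier_mat r r"
  using multiplier S_mat_in_SL2Z unfolding multiplier_system_def by blast

lemma S_action:
  assumes "v \<in> carrier_vec r" "k < r"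
  shows "(\<rho> S_mat *\<^sub>v v) $ k = (\<Sum>i<r. \<rho> S_mat $$ (k, i) * v $ i)"
  using assms S_carrier by (simp add: scalar_prod_def lessThan_atLeast0)

sublocale fourier_vector D r n0 \<kappa> "\<lambda>j i. \<rho> S_mat $$ (j, i)" "\<lambda>j m. a (freq D m) $ j" "\<lambda>j z. g z $ j"
proof
  show "D > 0" by (rule D_pos)
  show "n0 \<le> 1" by (rule n0)
  show "\<kappa> = 3/2 - real n0" by (rule \<kappa>)
  fix j assume j: "j < r"
  show "(\<lambda>z. g z $ j) holomorphic_on upper_half_plane"
    using cusp j unfolding cusp_form_def by blast
  show "summable (\<lambda>m. cmod (a (freq D m) $ j) * freq D m powr (- \<sigma>))" if "\<sigma> > 1 + \<kappa> / 2" for \<sigma>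
    using cusp j that unfolding cusp_form_def
    by (intro summable_of_bigo[OF D_pos, where q = "\<kappa> / 2" and f = "\<lambda>x. cmod (a x $ j)"]) auto
  fix z assume z: "Im z > 0"
  then have zH: "z \<in> upper_half_plane" by (simp add: upper_half_plane_def)
  have "((\<lambda>x. a x $ j * q_pow x z) has_sum (g z $ j)) (exponents (\<alpha> j))"
    using cusp j zH unfolding cusp_form_def by blast
  also have "?this \<longleftrightarrow> ((\<lambda>m. a (freq D m) $ j * q_pow (freq D m) z) has_sum (g z $ j)) UNIV"
    by (rule has_sum_freq_iff[OF D_pos])
       (use coeff_eq_0[OF j] coeff_eq_0_freq[OF j] in \<open>auto simp: exponents_def\<close>)
  finally show "(\<lambda>m. a (freq D m) $ j * q_pow (freq D m) z) sums (g z $ j)" by (rule has_sum_imp_sums)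
  have "g (moebius S_mat z) = automorphy \<kappa> \<rho> S_mat z *\<^sub>v g z" and gz: "g z \<in> carrier_vec r"
    using cusp zH S_mat_in_SL2Z unfolding cusp_form_def by blast+
  moreover have "moebius S_mat z = - 1 / z"
    by (simp add: moebius_def denom_def S_mat_entries[simplified])
  moreover have "(automorphy \<kappa> \<rho> S_mat z *\<^sub>v g z) $ j = z powr of_real \<kappa> * (\<Sum>i<r. \<rho> S_mat $$ (j, i) * g z $ i)"
    using S_carrier gz j
    by (simp add: automorphy_def denom_def S_mat_entries[simplified] scalar_prod_def lessThan_atLeast0
        sum_distrib_left mult.assoc)
  ultimately show "g (- 1 / z) $ j = z powr of_real \<kappa> * (\<Sum>i<r. \<rho> S_mat $$ (j, i) * g z $ i)" by simp
qed

lemma eichler_integral_eq: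
  assumes k: "k < r" and \<tau>: "Im \<tau> > 0"
  shows "eichler_integral r \<kappa> a \<tau> $ k = eichler k \<tau>"
proof -
  have "summable (\<lambda>m. cmod (of_real (freq D m powr (1 - \<kappa>)) * a (freq D m) $ k * q_pow (freq D m) \<tau>))"
    using fourier_summable[OF k \<tau>, of "1 - \<kappa>"] by (simp add: norm_mult norm_q_pow mult_ac)
  then show ?thesis
    unfolding eichler_integral_def eichler_def
    using infsum_freq[OF D_pos, of "\<lambda>x. of_real (x powr (1 - \<kappa>)) * a x $ k * q_pow x \<tau>"] coeff_eq_0_freq[OF k] k
    by simp
qed

lemma dirichlet_vec_eq:
  assumes k: "k < r" and s: "Re s > 1 + \<kappa> / 2"
  shows "dirichlet_vec r a s $ k = dirichlet k s"
proof -
  have "summable (\<lambda>m. cmod (a (freq D m) $ k * of_real (freq D m) powr (- s)))"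
    using dirichlet_summable[OF k s] freq_pos by (simp add: norm_mult norm_of_real_powr)
  then show ?thesis
    unfolding dirichlet_vec_def dirichlet_def
    using infsum_freq[OF D_pos, of "\<lambda>x. a x $ k * of_real x powr (- s)"] coeff_eq_0_freq[OF k] k
    by simp
qed

lemma eichler_asymptotic_expansion:
  "asymptotic_expansion r (eichler_integral r \<kappa> a) (\<lambda>l. vec r (\<lambda>k. asymptotic_coeff k l))"
  unfolding asymptotic_expansion_def
proof (intro conjI allI impI)
  fix k N :: nat and \<delta> :: real
  assume k: "k < r" and \<delta>: "\<delta> > 0"
  obtain C where C: "\<And>\<tau>. \<tau> \<in> half_sector \<delta> \<Longrightarrow>
      cmod (eichler k \<tau> - (\<Sum>l<N. asymptotic_coeff k l * \<tau> ^ l)) \<le> C * cmod \<tau> ^ N"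
    using eichler_asymptotics[OF k \<delta>] by blast
  show "(\<lambda>\<tau>. eichler_integral r \<kappa> a \<tau> $ k - (\<Sum>l<N. vec r (\<lambda>k. asymptotic_coeff k l) $ k * \<tau> ^ l))
      \<in> O[at 0 within {\<tau>. 0 < Im \<tau> \<and> \<delta> * cmod \<tau> \<le> Im \<tau>}](\<lambda>\<tau>. \<tau> ^ N)"
  proof (rule bigoI[of _ C])
    show "\<forall>\<^sub>F \<tau> in at 0 within {\<tau>. 0 < Im \<tau> \<and> \<delta> * cmod \<tau> \<le> Im \<tau>}.
      norm (eichler_integral r \<kappa> a \<tau> $ k - (\<Sum>l<N. vec r (\<lambda>k. asymptotic_coeff k l) $ k * \<tau> ^ l)) \<le> C * norm (\<tau> ^ N)"
      using C k by (auto simp: eventually_at_filter eichler_integral_eq half_sector_def norm_power)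
  qed
qed simp

lemma borel_continuation_alt: "borel_continuation k = (\<lambda>\<xi>. asymptotic_coeff k 0 / Gamma (of_real (2 - \<kappa>)) +
     borel_const n0 * pole_series D (stokes_coeff k) (\<xi> / (2 * of_real pi * \<i>)))"
  by (simp add: fun_eq_iff borel_continuation_def)

abbreviation borel_vec :: "complex \<Rightarrow> complex vec" where
  "borel_vec \<xi> \<equiv> vec r (\<lambda>k. \<xi> powr of_real (1 - \<kappa>) * borel_continuation k \<xi>)"

lemma borel_transform_eichler:
  "borel_transform r (2 - \<kappa>) (\<lambda>l. vec r (\<lambda>k. asymptotic_coeff k l))
     (- range (\<lambda>m. stokes_point (freq D m))) borel_vec"
  unfolding borel_transform_def
proof (intro conjI allI impI)
  show "open (- range (\<lambda>m. stokes_point (freq D m)))" "connected (- range (\<lambda>m. stokes_point (freq D m)))"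
    using stokes_points_complement[OF D_pos] by blast+
  show "0 \<in> - range (\<lambda>m. stokes_point (freq D m))"
    using stokes_points_complement(3)[OF D_pos] by simp
  fix k assume k: "k < r"
  show "\<forall>\<^sub>F \<xi> in at 0. (\<lambda>l. vec r (\<lambda>k. asymptotic_coeff k l) $ k * borel_monomial (2 - \<kappa> + real l) \<xi>) sums (borel_vec \<xi> $ k)"
    using borel_termwise[OF k] k by simp
  have "borel_continuation k analytic_on (- range (\<lambda>m. stokes_point (freq D m)))"
    unfolding borel_continuation_alt analytic_on_analytic_at[of _ "- range (\<lambda>m. stokes_point (freq D m))"]
    by (intro ballI pole_coefficients.borel_function_analytic[OF stokes_coeff_poles]) auto
  then have "borel_continuation k holomorphic_on (- range (\<lambda>m. stokes_point (freq D m)))"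
    by (rule analytic_imp_holomorphic)
  then show "\<exists>F. F holomorphic_on - range (\<lambda>m. stokes_point (freq D m)) \<and>
      (\<forall>\<xi>\<in>- range (\<lambda>m. stokes_point (freq D m)) - {0}. borel_vec \<xi> $ k = \<xi> powr of_real (2 - \<kappa> - 1) * F \<xi>)"
    using k by (intro exI[of _ "borel_continuation k"]) simp
qed simp

lemma borel_vec_meromorphic:
  assumes k: "k < r"
  shows "(\<lambda>\<xi>. borel_vec \<xi> $ k / \<xi> powr of_real (1 - \<kappa>)) meromorphic_on - {0}"
    and "z \<noteq> 0 \<Longrightarrow> is_pole (\<lambda>\<xi>. borel_vec \<xi> $ k / \<xi> powr of_real (1 - \<kappa>)) z \<Longrightarrow>
           z \<in> range (\<lambda>m. stokes_point (freq D m)) \<and> zorder (\<lambda>\<xi>. borel_vec \<xi> $ k / \<xi> powr of_real (1 - \<kappa>)) z = - 1"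
proof -
  have eq: "\<forall>\<^sub>F \<xi> in at z. borel_vec \<xi> $ k / \<xi> powr of_real (1 - \<kappa>) = borel_continuation k \<xi>" for z
    using eventually_neq_at_within[of 0 z UNIV] by eventually_elim (use k in simp)
  have "borel_continuation k meromorphic_on - {0}"
    unfolding borel_continuation_alt by (rule pole_coefficients.borel_function_meromorphic[OF stokes_coeff_poles])
  then show "(\<lambda>\<xi>. borel_vec \<xi> $ k / \<xi> powr of_real (1 - \<kappa>)) meromorphic_on - {0}"
    using meromorphic_on_cong[OF eq refl, of "- {0}"] by blast
  assume "is_pole (\<lambda>\<xi>. borel_vec \<xi> $ k / \<xi> powr of_real (1 - \<kappa>)) z"
  then have "is_pole (borel_continuation k) z" using is_pole_cong[OF eq refl] by blast
  then have "z \<in> range (\<lambda>m. stokes_point (freq D m)) \<and> zorder (borel_continuation k) z = - 1"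
    unfolding borel_continuation_alt by (rule pole_coefficients.borel_function_poles[OF stokes_coeff_poles])
  then show "z \<in> range (\<lambda>m. stokes_point (freq D m)) \<and> zorder (\<lambda>\<xi>. borel_vec \<xi> $ k / \<xi> powr of_real (1 - \<kappa>)) z = - 1"
    using zorder_cong[OF eq refl] by simp
qed

abbreviation stokes_const :: complex where
  "stokes_const \<equiv> (2 * of_real pi * \<i>)\<^sup>2 * (2 * of_real pi * \<i>) powr of_real (1 - \<kappa>) * borel_const n0"

abbreviation stokes_vec :: "real \<Rightarrow> complex vec" where
  "stokes_vec x \<equiv> (stokes_const * of_real (x powr (1 - \<kappa>))) \<cdot>\<^sub>v (\<rho> S_mat *\<^sub>v a x)"

lemma stokes_vec_freq:
  assumes "k < r"
  shows "stokes_vec (freq D m) $ k = stokes_const * of_real (freq D m powr (1 - \<kappa>)) * stokes_coeff k m"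
  using S_action[OF a_carrier assms, of "freq D m"] S_carrier assms
  by (simp add: stokes_coeff_def)

lemma borel_vec_local_form:
  assumes k: "k < r"
  shows "\<exists>h. h analytic_on {stokes_point (freq D m)} \<and> (\<forall>\<^sub>F \<xi> in at (stokes_point (freq D m)).
    borel_vec \<xi> $ k = - (stokes_vec (freq D m) $ k / (2 * of_real pi * \<i> * (\<xi> - stokes_point (freq D m)))) + h \<xi>)"
  using pole_coefficients.borel_function_local_form[OF stokes_coeff_poles[of k], where p = "1 - \<kappa>" and K = "borel_const n0"
      and c = "asymptotic_coeff k 0 / Gamma (of_real (2 - \<kappa>))" and k = m, folded borel_continuation_def] k
  unfolding stokes_vec_freq[OF k] by simp

text \<open>
  The terms of a convergent series are bounded, so the coefficients at \<open>\<mu>\<close> are \<open>O(\<mu>^2)\<close> and the Stokes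
  vectors are \<open>O(\<mu>^(3 - \<kappa>))\<close>, an exponent below 3.
\<close>
lemma stokes_vec_growth:
  assumes k: "k < r"
  shows "(\<lambda>m::nat. cmod (stokes_vec (real m / real D) $ k)) \<in> O(\<lambda>m. real m ^ 3)"
proof -
  have "summable (\<lambda>m. cmod (stokes_coeff k m) * freq D m powr (- 2))"
    using weight_bounds by (intro stokes_coeff_norm_summable) simp
  then have "Bseq (\<lambda>m. cmod (stokes_coeff k m) * freq D m powr (- 2))"
    by (intro convergent_imp_Bseq) (auto simp: convergent_def dest: summable_LIMSEQ_zero)
  then obtain M where M: "\<And>m. cmod (stokes_coeff k m) * freq D m powr (- 2) \<le> M"
    unfolding Bseq_def by auto
  have M0: "M \<ge> 0" using M[of 0] by (meson mult_nonneg_nonneg norm_ge_zero order_trans powr_ge_zero)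
  have le: "cmod (stokes_vec (real m / real D) $ k) \<le> (cmod stokes_const * M) * real m ^ 3" if m: "m \<ge> 1" for m
  proof -
    obtain n where n: "m = Suc n" using m by (cases m) auto
    have fr: "freq D n = real m / real D" by (simp add: freq_def n)
    have one: "freq D n powr (- 2) * freq D n powr 2 = 1"
      using freq_pos[of n] powr_add[of "freq D n" "- 2" 2] by simp
    have b: "cmod (stokes_coeff k n) \<le> M * freq D n powr 2"
      using mult_right_mono[OF M[of n] powr_ge_zero[of "freq D n" 2]] one
      by (simp only: mult.assoc mult_1_right)
    have "freq D n \<le> real m" using D_pos m unfolding fr by (simp add: field_simps)
    then have "freq D n powr (3 - \<kappa>) \<le> real m powr (3 - \<kappa>)"
      using weight_bounds freq_pos[of n] by (intro powr_mono2) auto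
    also have "\<dots> \<le> real m powr 3" using m weight_bounds by (intro powr_mono) auto
    finally have c: "freq D n powr (3 - \<kappa>) \<le> real m ^ 3" using m by (simp add: powr_numeral)
    have "cmod (stokes_vec (freq D n) $ k) = cmod stokes_const * (freq D n powr (1 - \<kappa>) * cmod (stokes_coeff k n))"
      unfolding stokes_vec_freq[OF k] norm_mult norm_of_real by (simp add: mult_ac)
    also have "\<dots> \<le> cmod stokes_const * (freq D n powr (1 - \<kappa>) * (M * freq D n powr 2))"
      using b by (intro mult_left_mono) auto
    also have "\<dots> = cmod stokes_const * M * freq D n powr (3 - \<kappa>)"
      by (simp add: mult_ac flip: powr_add)
    also have "\<dots> \<le> cmod stokes_const * M * real m ^ 3"
      using c M0 by (intro mult_left_mono) auto
    finally show ?thesis unfolding fr .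
  qed
  show ?thesis
    by (rule bigoI[of _ "cmod stokes_const * M"], rule eventually_mono[OF eventually_ge_at_top[of 1]])
       (use le in simp)
qed

text \<open>
  Multiplying by the reciprocal Gamma function, which is entire, keeps the continuation free of poles.
\<close>
definition dirichlet_continuation :: "nat \<Rightarrow> complex \<Rightarrow> complex" where
  "dirichlet_continuation k s = (2 * of_real pi) powr s * rGamma s * vmellin (\<lambda>z. g z $ k) 0 s"

lemma dirichlet_continuation_eq:
  assumes k: "k < r" and s: "Re s > 1 + \<kappa> / 2"
  shows "dirichlet_continuation k s = dirichlet k s"
proof -
  have "s \<notin> \<int>\<^sub>\<le>\<^sub>0" using s weight_bounds by (auto elim!: nonpos_Ints_cases)
  then have 1: "rGamma s * Gamma s = 1" by (simp add: rGamma_inverse_Gamma Gamma_eq_zero_iff)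
  have 2: "(2 * complex_of_real pi) powr s * (2 * of_real pi) powr (- s) = 1"
    using powr_add[of "2 * complex_of_real pi" s "- s"] by simp
  have "dirichlet_continuation k s = ((2 * of_real pi) powr s * (2 * of_real pi) powr (- s)) *
      (rGamma s * Gamma s) * dirichlet k s"
    unfolding dirichlet_continuation_def mellin_eq_dirichlet[OF k s] by (simp only: mult_ac)
  then show ?thesis unfolding 1 2 by simp
qed

lemma dirichlet_continuation_entire:
  "k < r \<Longrightarrow> dirichlet_continuation k holomorphic_on UNIV"
  unfolding dirichlet_continuation_def
  by (intro holomorphic_intros vmellin_entire fourier_rapid) auto

abbreviation stokes_dirichlet :: "complex \<Rightarrow> complex vec" where
  "stokes_dirichlet s \<equiv> (stokes_const * of_nat D powr (- s)) \<cdot>\<^sub>v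
     (\<rho> S_mat *\<^sub>v vec r (\<lambda>k. dirichlet_continuation k (s + of_real \<kappa> - 1)))"

lemma stokes_dirichlet_nth:
  assumes "k < r"
  shows "stokes_dirichlet s $ k = (stokes_const * of_nat D powr (- s)) *
     (\<Sum>i<r. \<rho> S_mat $$ (k, i) * dirichlet_continuation i (s + of_real \<kappa> - 1))"
  using S_action[of "vec r (\<lambda>k. dirichlet_continuation k (s + of_real \<kappa> - 1))" k] S_carrier assms by simp

lemma stokes_dirichlet_meromorphic:
  assumes k: "k < r"
  shows "(\<lambda>s. stokes_dirichlet s $ k) meromorphic_on UNIV"
proof -
  have "(\<lambda>s. dirichlet_continuation i (s + of_real \<kappa> - 1)) holomorphic_on UNIV" if "i < r" for i
    by (rule holomorphic_on_compose_gen[OF _ dirichlet_continuation_entire[OF that], unfolded comp_def])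
       (auto intro!: holomorphic_intros)
  then have "(\<lambda>s. stokes_dirichlet s $ k) holomorphic_on UNIV"
    unfolding stokes_dirichlet_nth[OF k] by (intro holomorphic_intros) (use D_pos in auto)
  then show ?thesis by (intro analytic_on_imp_meromorphic_on) (simp add: analytic_on_open)
qed

lemma stokes_dirichlet_has_sum:
  assumes k: "k < r" and s: "Re s > 2 - \<kappa> / 2"
  shows "((\<lambda>m::nat. stokes_vec (real m / real D) $ k * of_nat m powr (- s)) has_sum (stokes_dirichlet s $ k)) {1..}"
proof -
  define s' where "s' = s + of_real \<kappa> - 1"
  have s': "Re s' > 1 + \<kappa> / 2" using s by (simp add: s'_def)
  define K where "K = stokes_const * of_nat D powr (- s)"
  have term_eq: "stokes_vec (real (Suc m) / real D) $ k * of_nat (Suc m) powr (- s)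
      = K * (stokes_coeff k m * of_real (freq D m) powr (- s'))" for m
  proof -
    have "of_nat (Suc m) = (of_nat D * of_real (freq D m) :: complex)"
      using D_pos by (simp add: freq_def)
    then have n_eq: "of_nat (Suc m) powr (- s) = of_nat D powr (- s) * complex_of_real (freq D m) powr (- s)"
      using powr_times_real[of "of_nat D" "of_real (freq D m)" "- s"] freq_pos[of m] by (simp add: less_imp_le)
    have z_eq: "of_real (freq D m powr (1 - \<kappa>)) * complex_of_real (freq D m) powr (- s) = of_real (freq D m) powr (- s')"
    proof -
      have "of_real (freq D m powr (1 - \<kappa>)) = complex_of_real (freq D m) powr of_real (1 - \<kappa>)"
        using freq_pos[of m] by (intro powr_of_real[symmetric]) auto
      moreover have "complex_of_real (freq D m) powr of_real (1 - \<kappa>) * complex_of_real (freq D m) powr (- s)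
          = complex_of_real (freq D m) powr (of_real (1 - \<kappa>) + - s)" by (rule powr_add[symmetric])
      moreover have "of_real (1 - \<kappa>) + - s = - s'" by (simp add: s'_def)
      ultimately show ?thesis by simp
    qed
    show ?thesis
      unfolding freq_def[symmetric] stokes_vec_freq[OF k] n_eq z_eq[symmetric] K_def by (simp only: mult_ac)
  qed
  have "summable (\<lambda>m. cmod (K * (stokes_coeff k m * of_real (freq D m) powr (- s'))))"
    unfolding norm_mult norm_of_real_powr[OF freq_pos]
    using stokes_coeff_norm_summable[OF s', of k] by (intro summable_mult) simp
  moreover have "(\<lambda>m. K * (stokes_coeff k m * of_real (freq D m) powr (- s'))) sums (K * (\<Sum>i<r. \<rho> S_mat $$ (k, i) * dirichlet i s'))"
    by (intro sums_mult stokes_coeff_dirichlet s')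
  ultimately have "((\<lambda>m. K * (stokes_coeff k m * of_real (freq D m) powr (- s'))) has_sum
      (K * (\<Sum>i<r. \<rho> S_mat $$ (k, i) * dirichlet i s'))) UNIV"
    by (rule norm_summable_imp_has_sum)
  also have "K * (\<Sum>i<r. \<rho> S_mat $$ (k, i) * dirichlet i s') = stokes_dirichlet s $ k"
    unfolding stokes_dirichlet_nth[OF k] unfolding K_def s'_def[symmetric] using dirichlet_continuation_eq[OF _ s'] by simp
  finally have "((\<lambda>m. stokes_vec (real m / real D) $ k * of_nat m powr (- s)) \<circ> Suc has_sum (stokes_dirichlet s $ k)) UNIV"
    unfolding comp_def term_eq .
  then have "((\<lambda>m. stokes_vec (real m / real D) $ k * of_nat m powr (- s)) has_sum (stokes_dirichlet s $ k)) (range Suc)"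
    by (subst has_sum_reindex) auto
  moreover have "range Suc = {1..}" by (auto simp: image_iff Suc_le_eq gr0_conv_Suc)
  ultimately show ?thesis by simp
qed

lemma stokes_dirichlet_eq:
  assumes s: "Re s > 2 - \<kappa> / 2"
  shows "stokes_dirichlet s = (stokes_const * of_nat D powr (- s)) \<cdot>\<^sub>v
               (\<rho> S_mat *\<^sub>v dirichlet_vec r a (s + of_real \<kappa> - 1))"
proof -
  have s': "Re (s + of_real \<kappa> - 1) > 1 + \<kappa> / 2" using s by simp
  have "vec r (\<lambda>k. dirichlet_continuation k (s + of_real \<kappa> - 1)) = dirichlet_vec r a (s + of_real \<kappa> - 1)"
    using dirichlet_continuation_eq[OF _ s'] dirichlet_vec_eq[OF _ s']
    by (intro eq_vecI) (auto simp: dirichlet_vec_def)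
  then show ?thesis by simp
qed

abbreviation completed_vec :: "complex \<Rightarrow> complex vec" where
  "completed_vec s \<equiv> vec r (\<lambda>k. vmellin (\<lambda>z. g z $ k) 0 s)"

lemma completed_vec_eq:
  assumes s: "Re s > 1 + \<kappa> / 2"
  shows "completed_vec s = ((2 * of_real pi) powr (- s) * Gamma s) \<cdot>\<^sub>v dirichlet_vec r a s"
  using mellin_eq_dirichlet[OF _ s] dirichlet_vec_eq[OF _ s]
  by (intro eq_vecI) (auto simp: dirichlet_vec_def)

lemma completed_vec_functional_equation:
  "completed_vec s = (\<i> powr of_real \<kappa>) \<cdot>\<^sub>v (\<rho> S_mat *\<^sub>v completed_vec (of_real \<kappa> - s))"
proof (rule eq_vecI)
  fix k assume "k < dim_vec ((\<i> powr of_real \<kappa>) \<cdot>\<^sub>v (\<rho> S_mat *\<^sub>v completed_vec (of_real \<kappa> - s)))"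
  then have k: "k < r" using S_carrier by simp
  show "completed_vec s $ k = ((\<i> powr of_real \<kappa>) \<cdot>\<^sub>v (\<rho> S_mat *\<^sub>v completed_vec (of_real \<kappa> - s))) $ k"
    using mellin_functional_equation[OF k, of s] S_action[of "completed_vec (of_real \<kappa> - s)" k] S_carrier k
    by simp
qed (use S_carrier in simp)

end

section \<open>Resurgence of the Eichler integral\<close>

theorem mainTheorem7:
  fixes \<kappa> :: real
  assumes "\<kappa> \<in> {1/2, 3/2}"
  shows "\<exists>C::complex. C \<noteq> 0 \<and>
    (\<forall>(r::nat) (\<rho> :: int mat \<Rightarrow> complex mat) (\<alpha> :: nat \<Rightarrow> real)
      (g :: complex \<Rightarrow> complex vec) (a :: real \<Rightarrow> complex vec) (D::nat).
      r \<ge> 1 \<longrightarrow>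
      multiplier_system r \<kappa> \<rho> \<longrightarrow>
      unitary_multiplier r \<rho> \<longrightarrow>
      (\<forall>k<r. \<alpha> k \<in> \<rat> \<and> 0 \<le> \<alpha> k \<and> \<alpha> k < 1) \<longrightarrow>
      \<rho> T_mat = mat r r (\<lambda>(i, j). if i = j then exp (2 * of_real pi * \<i> * of_real (\<alpha> i)) else 0) \<longrightarrow>
      (\<exists>n>0. \<rho> T_mat ^\<^sub>m n = 1\<^sub>m r) \<longrightarrow>
      D = common_denominator r \<alpha> \<longrightarrow>
      cusp_form r \<kappa> \<rho> \<alpha> g a \<longrightarrow>
      (\<exists>(c :: nat \<Rightarrow> complex vec) (B :: complex \<Rightarrow> complex vec) (St :: real \<Rightarrow> complex vec).
        asymptotic_expansion r (eichler_integral r \<kappa> a) c \<and>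
        (let P = {stokes_point (real m / real D) | m::nat. m \<ge> 1} in
          borel_transform r (2 - \<kappa>) c (- P) B \<and>
          (\<forall>k<r. (\<lambda>\<xi>. B \<xi> $ k / \<xi> powr of_real (1 - \<kappa>)) meromorphic_on - {0} \<and>
            (\<forall>z. z \<noteq> 0 \<and> is_pole (\<lambda>\<xi>. B \<xi> $ k / \<xi> powr of_real (1 - \<kappa>)) z \<longrightarrow>
               z \<in> P \<and> zorder (\<lambda>\<xi>. B \<xi> $ k / \<xi> powr of_real (1 - \<kappa>)) z = - 1))) \<and>
        (\<forall>m::nat. m \<ge> 1 \<longrightarrow>
          (let \<mu> = real m / real D in
            (\<forall>k<r. \<exists>h. h analytic_on {stokes_point \<mu>} \<and>
               (\<forall>\<^sub>F \<xi> in at (stokes_point \<mu>).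
                  B \<xi> $ k = - (St \<mu> $ k / (2 * of_real pi * \<i> * (\<xi> - stokes_point \<mu>))) + h \<xi>)) \<and>
            St \<mu> = (C * of_real (\<mu> powr (1 - \<kappa>))) \<cdot>\<^sub>v (\<rho> S_mat *\<^sub>v a \<mu>))) \<and>
        (\<exists>p::nat. \<forall>k<r. (\<lambda>m::nat. cmod (St (real m / real D) $ k)) \<in> O(\<lambda>m. real m ^ p)) \<and>
        (\<exists>W :: complex \<Rightarrow> complex vec.
          (\<forall>s. W s \<in> carrier_vec r) \<and>
          (\<forall>k<r. (\<lambda>s. W s $ k) meromorphic_on UNIV) \<and>
          (\<forall>s. Re s > 2 - \<kappa> / 2 \<longrightarrow>
             (\<forall>k<r. ((\<lambda>m::nat. St (real m / real D) $ k * of_nat m powr (- s)) has_sum (W s $ k)) {1..}) \<and>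
             W s = (C * of_nat D powr (- s)) \<cdot>\<^sub>v
               (\<rho> S_mat *\<^sub>v dirichlet_vec r a (s + of_real \<kappa> - 1)))) \<and>
        (\<exists>\<Lambda> :: complex \<Rightarrow> complex vec.
          (\<forall>s. \<Lambda> s \<in> carrier_vec r) \<and>
          (\<forall>k<r. (\<lambda>s. \<Lambda> s $ k) holomorphic_on UNIV) \<and>
          (\<forall>s. Re s > 1 + \<kappa> / 2 \<longrightarrow>
             \<Lambda> s = ((2 * of_real pi) powr (- s) * Gamma s) \<cdot>\<^sub>v dirichlet_vec r a s) \<and>
          (\<forall>s. \<Lambda> s = (\<i> powr of_real \<kappa>) \<cdot>\<^sub>v (\<rho> S_mat *\<^sub>v \<Lambda> (of_real \<kappa> - s))))))"
proof -
  obtain n0 :: nat where n0: "n0 \<le> 1" "\<kappa> = 3/2 - real n0"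
    using assms by (auto intro: that[of 0] that[of 1])
  define C where "C = (2 * of_real pi * \<i>)\<^sup>2 * (2 * of_real pi * \<i>) powr of_real (1 - \<kappa>) * borel_const n0"
  have C0: "C \<noteq> 0" by (simp add: C_def borel_const_def)
  show ?thesis
    unfolding Let_def
  proof (rule exI[of _ C], intro conjI allI impI, goal_cases)
    case 1
    show ?case by (rule C0)
  next
    case (2 r \<rho> \<alpha> g a D)
    then interpret vector_cusp_form r n0 D \<kappa> \<rho> \<alpha> g a
      using n0 by unfold_locales auto
    have at_freq: "\<exists>n. real m / real D = freq D n" if "m \<ge> 1" for m
      using that by (intro exI[of _ "m - 1"]) (simp add: freq_def)
    show ?case
    proof (rule exI[of _ "\<lambda>l. vec r (\<lambda>k. asymptotic_coeff k l)"], rule exI[of _ borel_vec],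
        rule exI[of _ stokes_vec], intro conjI, goal_cases)
      case 1
      show ?case by (rule eichler_asymptotic_expansion)
    next
      case 2
      show ?case unfolding range_stokes_point_freq by (rule borel_transform_eichler)
    next
      case 3
      show ?case unfolding range_stokes_point_freq using borel_vec_meromorphic by blast
    next
      case 4
      show ?case
      proof (intro allI impI conjI)
        fix m k :: nat assume m: "m \<ge> 1" and k: "k < r"
        obtain n where n: "real m / real D = freq D n" using at_freq[OF m] by blast
        show "\<exists>h. h analytic_on {stokes_point (real m / real D)} \<and>
            (\<forall>\<^sub>F \<xi> in at (stokes_point (real m / real D)).
              borel_vec \<xi> $ k = - (stokes_vec (real m / real D) $ k /
                (2 * of_real pi * \<i> * (\<xi> - stokes_point (real m / real D)))) + h \<xi>)"
          unfolding n by (rule borel_vec_local_form[OF k])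
      qed (simp add: C_def)
    next
      case 5
      show ?case using stokes_vec_growth by blast
    next
      case 6
      show ?case
      proof (rule exI[of _ stokes_dirichlet], intro conjI allI impI)
        show "stokes_dirichlet s \<in> carrier_vec r" for s using S_carrier by simp
        show "k < r \<Longrightarrow> (\<lambda>s. stokes_dirichlet s $ k) meromorphic_on UNIV" for k
          by (rule stokes_dirichlet_meromorphic)
        show "Re s > 2 - \<kappa> / 2 \<Longrightarrow> k < r \<Longrightarrow>
            ((\<lambda>m::nat. stokes_vec (real m / real D) $ k * of_nat m powr (- s)) has_sum (stokes_dirichlet s $ k)) {1..}" for s k
          by (rule stokes_dirichlet_has_sum)
        show "Re s > 2 - \<kappa> / 2 \<Longrightarrow> stokes_dirichlet s =
            (C * of_nat D powr (- s)) \<cdot>\<^sub>v (\<rho> S_mat *\<^sub>v dirichlet_vec r a (s + of_real \<kappa> - 1))" for s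
          unfolding C_def by (rule stokes_dirichlet_eq)
      qed
    next
      case 7
      show ?case
      proof (rule exI[of _ completed_vec], intro conjI allI impI)
        show "k < r \<Longrightarrow> (\<lambda>s. completed_vec s $ k) holomorphic_on UNIV" for k
          using vmellin_entire[OF fourier_rapid, of k] by simp
        show "Re s > 1 + \<kappa> / 2 \<Longrightarrow>
            completed_vec s = ((2 * of_real pi) powr (- s) * Gamma s) \<cdot>\<^sub>v dirichlet_vec r a s" for s
          by (rule completed_vec_eq)
        show "completed_vec s = (\<i> powr of_real \<kappa>) \<cdot>\<^sub>v (\<rho> S_mat *\<^sub>v completed_vec (of_real \<kappa> - s))" for s
          by (rule completed_vec_functional_equation)
      qed simp
    qed
  qed
qed

end
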